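(* For every solenoid $\Sigma$ there exists an embedding $\Sigma\subset S^3$ such that $\pi_1(S^3-\Sigma)$ is Abelian, and in fact isomorphic to a subgroup of the additive group $\mathbb{Q}$. Furthermore, for every nontrivial subgroup $G\leq(\mathbb{Q},+)$ there exist a solenoid $\Sigma$ and an embedding $\Sigma\subset S^3$ such that $\pi_1(S^3-\Sigma)\cong G$.
   Context: Given a sequence $\{n_i\}_{i\ge1}$ of positive integers, let $f_i:S^1\to S^1$, $f_i(z)=z^{n_i}$, where $S^1$ is the unit circle in $\mathbb{C}$. The solenoid with defining sequence $\{n_i\}$ is the inverse limit $\Sigma(n_i)=\varprojlim(S^1,f_i)$. A solenoid is a space homeomorphic to some $\Sigma(n_i)$; the circle (all $n_i$ eventually equal to $1$) counts as a solenoid here. Convention on embeddings: all embeddings of solenoids in $S^3$ are obtained as nested intersections of solid tori. That is, for some defining sequence $\{n_i\}$ of $\Sigma$, there are tame solid tori $T_0\supset T_1\supset T_2\supset\cdots$ in $S^3$ such that for each $i\ge1$, $T_i$ lies in the interior of $T_{i-1}$ and is a tubular neighborhood of a closed braid on $n_i$ strands in $T_{i-1}$ whose permutation of the strands is transitive (so that the closed braid is a single closed curve), the cross-sectional diameters $d_i$ of $T_i$ satisfy $d_i<d_{i-1}/2$, and the embedded copy of $\Sigma$ is $\bigcap_i T_i$. *)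

theory Defs
  imports "HOL-Analysis.Analysis" "HOL-Algebra.Elementary_Groups" "HOL-Combinatorics.Permutations"
begin

section \<open>Solenoids\<close>

text \<open>The defining sequence is indexed from 1; the value \<open>n 0\<close> is never used. A thread is
  \<open>x 0, x 1, x 2, \<dots>\<close> with \<open>x (i - 1) = (x i) ^ n i\<close> for every \<open>i \<ge> 1\<close>.\<close>

definition defining_sequence :: "(nat \<Rightarrow> nat) \<Rightarrow> bool" where
  "defining_sequence n \<longleftrightarrow> (\<forall>i\<ge>1. n i \<ge> 1)"

definition solenoid_space :: "(nat \<Rightarrow> nat) \<Rightarrow> (nat \<Rightarrow> complex) topology" where
  "solenoid_space n =
     subtopology (product_topology (\<lambda>i. top_of_set (sphere 0 1)) UNIV)
       {x. \<forall>i. x i = x (Suc i) ^ n (Suc i)}"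

definition solenoid :: "'a topology \<Rightarrow> bool" where
  "solenoid \<Sigma> \<longleftrightarrow> (\<exists>n. defining_sequence n \<and> \<Sigma> homeomorphic_space solenoid_space n)"


section \<open>Solid tori and closed braids in the 3-sphere\<close>

abbreviation S3 :: "(real^4) set" where
  "S3 \<equiv> sphere 0 1"

abbreviation solid_torus :: "(complex \<times> complex) set" where
  "solid_torus \<equiv> sphere 0 1 \<times> cball 0 1"

text \<open>A proper subset of the 3-sphere is tame if some homeomorphism of the 3-sphere onto
  \<open>\<real>\<^sup>3 \<union> {\<infinity>}\<close> carries it to a (compact) polyhedron in \<open>\<real>\<^sup>3\<close>. Homeomorphisms with \<open>p \<mapsto> \<infinity>\<close>
  are the same as homeomorphisms of the complement of \<open>p\<close> onto \<open>\<real>\<^sup>3\<close>. A polyhedron is a finite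
  union of compact convex polytopes, not necessarily convex (unlike the library's
  \<open>polyhedron\<close>).\<close>

definition tame :: "(real^4) set \<Rightarrow> bool" where
  "tame A \<longleftrightarrow> A \<subseteq> S3 \<and>
     (\<exists>p \<in> S3 - A. \<exists>(g :: real^4 \<Rightarrow> real^3) g' P.
        homeomorphism (S3 - {p}) UNIV g g' \<and>
        finite P \<and> (\<forall>c\<in>P. polytope c) \<and> g ` A = \<Union>P)"

text \<open>Solid tori in the 3-sphere come with a parametrization \<open>h\<close>, which supplies the meridian
  discs \<open>h ` ({z} \<times> cball 0 1)\<close> and the core \<open>h ` (sphere 0 1 \<times> {0})\<close>.\<close>

definition tame_solid_torus :: "(complex \<times> complex \<Rightarrow> real^4) \<Rightarrow> bool" where
  "tame_solid_torus h \<longleftrightarrow>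
     embedding_map (top_of_set solid_torus) (top_of_set S3) h \<and> tame (h ` solid_torus)"

definition cross_diameter :: "(complex \<times> complex \<Rightarrow> real^4) \<Rightarrow> real" where
  "cross_diameter h = (SUP z \<in> sphere 0 1. diameter (h ` ({z} \<times> cball 0 1)))"

text \<open>A braid on \<open>n\<close> strands in the open disc: \<open>b j\<close> is the \<open>j\<close>-th strand, and \<open>\<sigma>\<close> is the
  induced permutation of the strands.\<close>

definition braid :: "nat \<Rightarrow> (nat \<Rightarrow> real \<Rightarrow> complex) \<Rightarrow> (nat \<Rightarrow> nat) \<Rightarrow> bool" where
  "braid n b \<sigma> \<longleftrightarrow>
     (\<forall>j<n. continuous_on {0..1} (b j)) \<and>
     (\<forall>j<n. \<forall>t\<in>{0..1}. b j t \<in> ball 0 1) \<and>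
     (\<forall>j<n. \<forall>k<n. j \<noteq> k \<longrightarrow> (\<forall>t\<in>{0..1}. b j t \<noteq> b k t)) \<and>
     \<sigma> permutes {..<n} \<and>
     (\<forall>j<n. b j 1 = b (\<sigma> j) 0)"

definition transitive_perm :: "nat \<Rightarrow> (nat \<Rightarrow> nat) \<Rightarrow> bool" where
  "transitive_perm n \<sigma> \<longleftrightarrow> (\<forall>j<n. \<forall>k<n. \<exists>m. (\<sigma> ^^ m) j = k)"

definition closed_braid :: "nat \<Rightarrow> (nat \<Rightarrow> real \<Rightarrow> complex) \<Rightarrow> (complex \<times> complex) set" where
  "closed_braid n b = {(cis (2 * pi * t), b j t) | j t. j < n \<and> t \<in> {0..1}}"

text \<open>\<open>K\<close> is the core of the parametrized solid torus \<open>h\<close>.\<close>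

definition tubular_nbhd_of :: "(complex \<times> complex \<Rightarrow> real^4) \<Rightarrow> (real^4) set \<Rightarrow> bool" where
  "tubular_nbhd_of h K \<longleftrightarrow> h ` (sphere 0 1 \<times> {0}) = K"

definition nested_braided_tori ::
    "(nat \<Rightarrow> nat) \<Rightarrow> (nat \<Rightarrow> complex \<times> complex \<Rightarrow> real^4) \<Rightarrow> bool" where
  "nested_braided_tori n h \<longleftrightarrow>
     (\<forall>i. tame_solid_torus (h i)) \<and>
     (\<forall>i. h (Suc i) ` solid_torus \<subseteq> (top_of_set S3) interior_of (h i ` solid_torus)) \<and>
     (\<forall>i. \<exists>b \<sigma>. braid (n (Suc i)) b \<sigma> \<and> transitive_perm (n (Suc i)) \<sigma> \<and>
            tubular_nbhd_of (h (Suc i)) (h i ` closed_braid (n (Suc i)) b)) \<and>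
     (\<forall>i. cross_diameter (h (Suc i)) < cross_diameter (h i) / 2)"

text \<open>Being homeomorphic to the solenoid of the sequence \<open>n\<close> is required of the intersection
  explicitly (through \<open>e\<close>), not inferred from the shape of the tori.\<close>

definition solenoid_embedding :: "'a topology \<Rightarrow> ('a \<Rightarrow> real^4) \<Rightarrow> bool" where
  "solenoid_embedding \<Sigma> e \<longleftrightarrow>
     embedding_map \<Sigma> (top_of_set S3) e \<and>
     (\<exists>n h. defining_sequence n \<and> \<Sigma> homeomorphic_space solenoid_space n \<and>
        nested_braided_tori n h \<and>
        e ` topspace \<Sigma> = (\<Inter>i. h i ` solid_torus))"


section \<open>Groups\<close>

definition loops :: "'a::topological_space set \<Rightarrow> 'a \<Rightarrow> (real \<Rightarrow> 'a) set" where
  "loops S x = {p. path p \<and> path_image p \<subseteq> S \<and> pathstart p = x \<and> pathfinish p = x}"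

definition fundamental_group ::
    "'a::real_normed_vector set \<Rightarrow> 'a \<Rightarrow> (real \<Rightarrow> 'a) set monoid" where
  "fundamental_group S x =
     \<lparr>carrier = loops S x // {(p, q). homotopic_paths S p q},
      monoid.mult = (\<lambda>A B. \<Union>p\<in>A. \<Union>q\<in>B. {r. homotopic_paths S (p +++ q) r}),
      one = {r. homotopic_paths S (linepath x x) r}\<rparr>"

lemma group_fundamental_group:
  assumes "x \<in> S"
  shows "group (fundamental_group S x)"
proof -
  define c where "c p = {r. homotopic_paths S p r}" for p
  have carr: "carrier (fundamental_group S x) = c ` loops S x"
    by (auto simp: fundamental_group_def quotient_def c_def)
  have c_eq: "c p = c q" if "homotopic_paths S p q" for p q
    using that unfolding c_def by (blast intro: homotopic_paths_trans homotopic_paths_sym)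
  have mult: "c p \<otimes>\<^bsub>fundamental_group S x\<^esub> c q = c (p +++ q)"
    if "p \<in> loops S x" "q \<in> loops S x" for p q
  proof -
    have "c (p' +++ q') = c (p +++ q)" if "p' \<in> c p" "q' \<in> c q" for p' q'
    proof -
      have "homotopic_paths S (p +++ q) (p' +++ q')"
        using that \<open>p \<in> loops S x\<close> \<open>q \<in> loops S x\<close>
        by (intro homotopic_paths_join) (auto simp: c_def loops_def)
      then show ?thesis using c_eq by metis
    qed
    moreover have "p \<in> c p" "q \<in> c q"
      using that by (auto simp: c_def loops_def)
    moreover have "c p \<otimes>\<^bsub>fundamental_group S x\<^esub> c q = (\<Union>p'\<in>c p. \<Union>q'\<in>c q. c (p' +++ q'))"
      by (simp add: fundamental_group_def c_def)
    ultimately show ?thesis by blast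
  qed
  have one: "\<one>\<^bsub>fundamental_group S x\<^esub> = c (linepath x x)"
    by (simp add: fundamental_group_def c_def)
  have triv: "linepath x x \<in> loops S x"
    using assms by (simp add: loops_def)
  have join: "p +++ q \<in> loops S x" if "p \<in> loops S x" "q \<in> loops S x" for p q
    using that by (auto simp: loops_def path_image_join)
  have rev: "reversepath p \<in> loops S x" if "p \<in> loops S x" for p
    using that by (auto simp: loops_def)
  show ?thesis
  proof (rule groupI)
    fix A B D
    assume "A \<in> carrier (fundamental_group S x)"
    then obtain p where p: "p \<in> loops S x" "A = c p" by (auto simp: carr)
    have "homotopic_paths S (linepath x x +++ p) p"
      using p homotopic_paths_lid[of p S] by (auto simp: loops_def)
    then show "\<one>\<^bsub>fundamental_group S x\<^esub> \<otimes>\<^bsub>fundamental_group S x\<^esub> A = A"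
      using p triv c_eq by (simp add: one mult)
    have "homotopic_paths S (reversepath p +++ p) (linepath x x)"
      using p homotopic_paths_linv[of p S] by (auto simp: loops_def)
    then have "c (reversepath p) \<otimes>\<^bsub>fundamental_group S x\<^esub> A = \<one>\<^bsub>fundamental_group S x\<^esub>"
      using p rev c_eq by (simp add: one mult)
    then show "\<exists>y\<in>carrier (fundamental_group S x).
        y \<otimes>\<^bsub>fundamental_group S x\<^esub> A = \<one>\<^bsub>fundamental_group S x\<^esub>"
      using rev p carr by blast
    assume "B \<in> carrier (fundamental_group S x)"
    then obtain q where q: "q \<in> loops S x" "B = c q" by (auto simp: carr)
    show "A \<otimes>\<^bsub>fundamental_group S x\<^esub> B \<in> carrier (fundamental_group S x)"
      using p q join by (auto simp: mult carr)
    assume "D \<in> carrier (fundamental_group S x)"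
    then obtain r where r: "r \<in> loops S x" "D = c r" by (auto simp: carr)
    have "homotopic_paths S (p +++ (q +++ r)) ((p +++ q) +++ r)"
      using p q r by (intro homotopic_paths_assoc) (auto simp: loops_def)
    then show "A \<otimes>\<^bsub>fundamental_group S x\<^esub> B \<otimes>\<^bsub>fundamental_group S x\<^esub> D =
        A \<otimes>\<^bsub>fundamental_group S x\<^esub> (B \<otimes>\<^bsub>fundamental_group S x\<^esub> D)"
      using p q r join c_eq by (simp add: mult)
  qed (use triv in \<open>auto simp: carr one\<close>)
qed

definition rat_group :: "rat monoid" where
  "rat_group = \<lparr>carrier = UNIV, monoid.mult = (+), one = 0\<rparr>"

lemma group_rat_group: "group rat_group"
  by (rule groupI) (auto simp: rat_group_def intro: exI[of _ "- x" for x])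

end

theory Submission
  imports Defs "HOL-Complex_Analysis.Complex_Analysis"
begin

text \<open>
  Every torus of the nested sequence is kept unknotted. Let \<open>V\<close> be the solid torus
  \<open>|w| \<le> 4/5\<close> in the 3-sphere \<open>|z|\<^sup>2 + |w|\<^sup>2 = 1\<close>. For every \<open>n \<ge> 1\<close> there is a homeomorphism
  \<open>\<phi>\<close> of the 3-sphere that maps \<open>V\<close> to a thin neighbourhood, inside \<open>V\<close>, of the closed \<open>n\<close>-braid
  \<open>\<zeta> \<mapsto> (\<zeta>\<^sup>n, a \<zeta>)\<close>. This torus knot is unknotted because it winds only once around the
  complementary solid torus; there it is a section of the projection to the \<open>w\<close>-direction, and
  \<open>\<phi>\<close> exchanges the two coordinates and pushes the core of the complementary torus onto this
  section (\<open>cabling\<close>). Compositions of such homeomorphisms yield the tori, all of which are images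
  of \<open>V\<close> under homeomorphisms of the sphere (\<open>cable_tower_exists\<close>). Hence they are tame as soon as
  \<open>V\<close> is (\<open>tame_standard_torus_image\<close>), and their cross-sections can be made as thin as required,
  by uniform continuity.

  The homeomorphisms are arranged so that every meridian disc of a torus lies inside a meridian
  disc of the preceding one, over the \<open>n\<close>-th power of its parameter. A point of the intersection
  is then determined by the parameters of the discs that contain it, and these parameters form a
  thread of the solenoid (\<open>solenoid_intersection\<close>).

  The complement of \<open>V\<close> is an open solid torus, whose loops are classified by the winding number of
  \<open>w\<close>. The core of the complement of one torus winds \<open>n\<close> times around the next torus, so passing to
  the next complement multiplies winding numbers by \<open>n\<close> (\<open>torus_complement_degree\<close>). A compact set
  that misses the intersection misses one of the tori. The fundamental group of the complement of
  the solenoid is thus the direct limit of copies of the integers under multiplication by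
  \<open>n 1, n 2, \<dots>\<close>, that is, the group of all fractions with a denominator
  \<open>n 1 * \<dots> * n i\<close> (\<open>fundamental_group_tower\<close>). Up to isomorphism, these are all the
  nontrivial subgroups of the rationals (\<open>nontrivial_rat_subgroup_iso_fractions_group\<close>).
\<close>

section \<open>Cabling homeomorphisms of the 3-sphere\<close>

abbreviation S3C :: "(complex \<times> complex) set" where
  "S3C \<equiv> sphere 0 1"

abbreviation circ :: "complex set" where
  "circ \<equiv> sphere 0 1"

lemma mem_S3C: "(z, w) \<in> S3C \<longleftrightarrow> (cmod z)\<^sup>2 + (cmod w)\<^sup>2 = 1"
  by (simp add: norm_prod_def)

text \<open>The braided core is placed at a value of \<open>|z|\<close> close to this constant. It is larger than \<open>3/5\<close>, so
  that the core lies in the torus \<open>|w| < 4/5\<close>, which is \<open>|z| > 3/5\<close>; it is smaller than \<open>4/5\<close> for the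
  sake of injectivity of \<open>disc_push\<close> below.\<close>
definition core_offset :: real where
  "core_offset = 7/10"

definition push_weight :: "real \<Rightarrow> real \<Rightarrow> real" where
  "push_weight d r = max d (d + (1 - d) * (5 * r - 4))"

text \<open>A homeomorphism of the closed disc that fixes the boundary and shrinks the disc of radius \<open>4/5\<close>,
  by the factor \<open>d\<close>, to a small disc near \<open>core_offset\<close>. It maps each circle about the origin to the
  circle obtained by a dilation, with a factor depending on the radius, about \<open>core_offset\<close>.\<close>
definition disc_push :: "real \<Rightarrow> complex \<Rightarrow> complex" where
  "disc_push d u = of_real (push_weight d (cmod u)) * u
     + of_real ((1 - push_weight d (cmod u)) * core_offset)"

context
  fixes d :: real
  assumes d: "0 < d" "d \<le> 1/20"
begin

lemma push_weight_bounds: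
  assumes "r \<le> 1"
  shows "0 < push_weight d r" "push_weight d r \<le> 1"
proof -
  have h: "(1 - d) * (5 * r - 4) \<le> (1 - d) * 1"
    using assms d by (intro mult_left_mono) auto
  have h': "d + (1 - d) * (5 * r - 4) \<le> 1"
    using add_left_mono[OF h, of d] by simp
  show "0 < push_weight d r" using d by (simp add: push_weight_def less_max_iff_disj)
  show "push_weight d r \<le> 1" using h' d unfolding push_weight_def by (intro max.boundedI) auto
qed

lemma push_weight_low:
  assumes "r \<le> 4/5"
  shows "push_weight d r = d"
proof -
  have "(1 - d) * (5 * r - 4) \<le> 0" using d assms by (intro mult_nonneg_nonpos) auto
  then show ?thesis unfolding push_weight_def by linarith
qed

lemma push_weight_1: "push_weight d 1 = 1"
  using d by (auto simp: push_weight_def max_def)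

lemma push_weight_mono: "r \<le> s \<Longrightarrow> push_weight d r \<le> push_weight d s"
proof -
  assume "r \<le> s"
  then have "(1 - d) * (5 * r - 4) \<le> (1 - d) * (5 * s - 4)"
    using d by (intro mult_left_mono) auto
  then show ?thesis by (auto simp: push_weight_def)
qed

lemma continuous_disc_push: "continuous_on X (disc_push d)"
  unfolding disc_push_def push_weight_def by (intro continuous_intros)

lemma disc_push_low:
  "cmod u \<le> 4/5 \<Longrightarrow> disc_push d u = of_real d * u + of_real ((1 - d) * core_offset)"
  by (simp add: disc_push_def push_weight_low)

lemma disc_push_boundary: "cmod u = 1 \<Longrightarrow> disc_push d u = u"
  by (simp add: disc_push_def push_weight_1)

lemma disc_push_interior:
  assumes "cmod u < 1"
  shows "cmod (disc_push d u) < 1"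
proof -
  let ?m = "push_weight d (cmod u)"
  have m: "0 < ?m" "?m \<le> 1" using push_weight_bounds[of "cmod u"] assms by auto
  have "cmod (disc_push d u) \<le> ?m * cmod u + (1 - ?m) * core_offset"
    unfolding disc_push_def using m
    by (intro order_trans[OF norm_triangle_ineq])
      (simp add: norm_mult core_offset_def del: of_real_mult of_real_diff)
  also have "\<dots> < ?m * 1 + (1 - ?m) * 1"
  proof -
    have "?m * cmod u < ?m * 1" using assms m by (intro mult_strict_left_mono) auto
    moreover have "(1 - ?m) * core_offset \<le> (1 - ?m) * 1" 
      using m by (intro mult_left_mono) (auto simp: core_offset_def)
    ultimately show ?thesis by linarith
  qed
  finally show ?thesis by simp
qed

text \<open>Two points at different distances from the origin have different images because the
  circles \<open>|u| = r\<close> are mapped to nested disjoint circles: beyond radius \<open>4/5\<close>, where the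
  centres move, the radii grow faster than the centres move, as \<open>7/10 < 4/5\<close>.\<close>

lemma inj_disc_push: "inj_on (disc_push d) (cball 0 1)"
proof -
  have neq: "disc_push d u \<noteq> disc_push d v" if uv: "cmod u < cmod v" "cmod v \<le> 1" for u v
  proof
    assume eq: "disc_push d u = disc_push d v"
    let ?m = "push_weight d (cmod u)" and ?n = "push_weight d (cmod v)"
    have m: "0 < ?m" "?m \<le> ?n"
      using push_weight_bounds[of "cmod u"] push_weight_mono[of "cmod u" "cmod v"] uv by auto
    from eq have "of_real ?n * v = of_real ?m * u + of_real ((?n - ?m) * core_offset)"
      unfolding disc_push_def by (simp add: algebra_simps)
    then have "cmod (of_real ?n * v) = cmod (of_real ?m * u + of_real ((?n - ?m) * core_offset))"
      by simp
    also have "\<dots> \<le> cmod (of_real ?m * u) + cmod (of_real ((?n - ?m) * core_offset))"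
      by (rule norm_triangle_ineq)
    finally have le: "?n * cmod v \<le> ?m * cmod u + (?n - ?m) * core_offset"
      using m by (simp add: norm_mult core_offset_def del: of_real_mult of_real_diff)
    have 1: "?m * cmod u < ?m * cmod v" using m uv by simp
    have 2: "(?n - ?m) * core_offset \<le> (?n - ?m) * cmod v"
    proof (cases "cmod v \<le> 4/5")
      case True
      then have "?m = ?n" using push_weight_low uv by simp
      then show ?thesis by simp
    next
      case False
      then show ?thesis using m by (intro mult_left_mono) (auto simp: core_offset_def)
    qed
    show False using le 1 2 by (simp add: algebra_simps)
  qed
  show ?thesis
  proof (rule inj_onI)
    fix u v assume uv: "u \<in> cball 0 1" "v \<in> cball 0 1" "disc_push d u = disc_push d v"
    then have eq: "cmod u = cmod v"
      using neq[of u v] neq[of v u] by (metis linorder_cases mem_cball_0)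
    then have "of_real (push_weight d (cmod v)) * (u - v) = 0"
      using uv(3) by (simp add: disc_push_def right_diff_distrib)
    then show "u = v" using push_weight_bounds[of "cmod v"] uv by auto
  qed
qed

text \<open>A point on the image of the circle of radius \<open>r\<close> is found by the intermediate value theorem: the
  image circles start at a single point and end at the unit circle.\<close>
lemma disc_push_cball: "disc_push d ` cball 0 1 = cball 0 1"
proof
  show "disc_push d ` cball 0 1 \<subseteq> cball 0 1"
    using disc_push_interior disc_push_boundary by (force simp: less_le)
  show "cball 0 1 \<subseteq> disc_push d ` cball 0 1"
  proof
    fix y :: complex assume y: "y \<in> cball 0 1"
    let ?g = "\<lambda>r. cmod (y - of_real ((1 - push_weight d r) * core_offset)) - push_weight d r * r"
    have "\<exists>r. 0 \<le> r \<and> r \<le> 1 \<and> ?g r = 0"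
    proof (rule IVT2')
      show "?g 1 \<le> 0" "0 \<le> ?g 0" using y by (auto simp: push_weight_1)
      show "continuous_on {0..1} ?g"
        unfolding push_weight_def by (intro continuous_intros)
    qed auto
    then obtain r where r: "0 \<le> r" "r \<le> 1" "?g r = 0" by auto
    define u where "u = (y - of_real ((1 - push_weight d r) * core_offset)) / of_real (push_weight d r)"
    have m: "push_weight d r > 0" using push_weight_bounds r by auto
    have "cmod u = r" using r m by (simp add: u_def norm_divide)
    then have "disc_push d u = y" using m by (simp add: disc_push_def u_def)
    then show "y \<in> disc_push d ` cball 0 1" using \<open>cmod u = r\<close> r by force
  qed
qed

end

text \<open>The discs about the new core that are cut out by a fixed direction of \<open>w\<close> are not contained in
  discs with a fixed direction of \<open>z\<close>. Sliding the points of the new torus along its core by this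
  angle aligns them; they are the points with \<open>|u| \<le> 4/5\<close>. The first factor makes it vanish on the
  unit circle, where the circle coordinate is collapsed, and the retraction to the disc of radius
  \<open>4/5\<close> keeps the argument function away from its branch cut.\<close>
definition twist_angle :: "nat \<Rightarrow> real \<Rightarrow> complex \<Rightarrow> real" where
  "twist_angle n d u = - min 1 (5 * (1 - cmod u)) *
     Arg (of_real d * (u / of_real (max 1 (5/4 * cmod u))) + of_real ((1 - d) * core_offset)) / n"

lemma small_disc_near:
  assumes "0 < d" "d \<le> 1/20" "cmod u \<le> 4/5"
  shows "cmod (of_real d * u + of_real ((1 - d) * core_offset) - of_real core_offset) \<le> 2 * d"
proof -
  have "of_real d * u + of_real ((1 - d) * core_offset) - of_real core_offset = of_real d * (u - of_real core_offset)"
    by (simp add: algebra_simps)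
  then have "cmod (of_real d * u + of_real ((1 - d) * core_offset) - of_real core_offset) = d * cmod (u - of_real core_offset)"
    using assms by (simp only: norm_mult norm_of_real)
  also have "cmod (u - of_real core_offset) \<le> 4/5 + core_offset"
    using assms norm_triangle_ineq4[of u "of_real core_offset"] by (simp add: core_offset_def)
  also have "d * (4/5 + core_offset) \<le> 2 * d" using assms by (simp add: core_offset_def)
  finally show ?thesis using assms by simp
qed

lemma small_disc_right:
  assumes "0 < d" "d \<le> 1/20" "cmod u \<le> 4/5"
  shows "3/5 < Re (of_real d * u + of_real ((1 - d) * core_offset))"
proof -
  have "d * (- Re u) \<le> d * (4/5)"
    using assms abs_Re_le_cmod[of u] by (intro mult_left_mono) auto
  moreover have "(1 - d) * core_offset \<ge> 133/200"
    using assms by (simp add: core_offset_def)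
  ultimately show ?thesis using assms by simp
qed

lemma continuous_twist_angle:
  assumes "0 < d" "d \<le> 1/20"
  shows "continuous_on X (twist_angle n d)"
proof -
  have low: "cmod (u / of_real (max 1 (5/4 * cmod u))) \<le> 4/5" for u
    by (auto simp: norm_divide divide_simps)
  have "of_real d * (u / of_real (max 1 (5/4 * cmod u))) + of_real ((1 - d) * core_offset) \<notin> \<real>\<^sub>\<le>\<^sub>0" for u
    using small_disc_right[OF assms low, of u] unfolding complex_nonpos_Reals_iff by linarith
  moreover have "(of_real (max 1 (5/4 * cmod u)) :: complex) \<noteq> 0" for u
    by (simp only: of_real_eq_0_iff)
  moreover have "continuous_on (- \<real>\<^sub>\<le>\<^sub>0) Arg"
    by (auto simp: continuous_on_eq_continuous_at continuous_at_Arg open_Compl)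
  ultimately show ?thesis
    unfolding twist_angle_def divide_inverse[of _ "real n"]
    by (intro continuous_intros continuous_on_compose2[of "- \<real>\<^sub>\<le>\<^sub>0" Arg]) auto
qed

lemma twist_angle_boundary: "cmod u = 1 \<Longrightarrow> twist_angle n d u = 0"
  by (simp add: twist_angle_def)

lemma twist_angle_low:
  assumes "0 < d" "d \<le> 1/20" "cmod u \<le> 4/5"
  shows "twist_angle n d u = - Arg (disc_push d u) / n"
proof -
  have "max 1 (5/4 * cmod u) = 1" "min 1 (5 * (1 - cmod u)) = 1" using assms by auto
  then show ?thesis unfolding twist_angle_def disc_push_low[OF assms] by simp
qed

text \<open>The 3-sphere as the quotient of \<open>disc \<times> circle\<close> that collapses the circle factor over the boundary
  of the disc. The disc factor is the second complex coordinate.\<close>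
definition join_map :: "complex \<times> complex \<Rightarrow> complex \<times> complex" where
  "join_map = (\<lambda>(y, \<eta>). (of_real (sqrt (1 - (cmod y)\<^sup>2)) * \<eta>, y))"

text \<open>The cabling homeomorphism in \<open>disc \<times> circle\<close> coordinates; the result is to be read with the two
  complex coordinates exchanged. Without the rotations by \<open>n\<close>-th powers, this would be
  \<open>disc_push\<close> on the disc factor and a slide along the circle factor. The second rotation spreads
  the new core out to a section \<open>\<eta> \<mapsto> c \<eta>\<^sup>n\<close> with constant \<open>c\<close>, and the first one makes the map the identity over
  the boundary of the disc, as required for compatibility with the collapsing.\<close>
definition braid_map :: "nat \<Rightarrow> real \<Rightarrow> complex \<times> complex \<Rightarrow> complex \<times> complex" where
  "braid_map n d = (\<lambda>(y, \<eta>).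
     let u = y / \<eta> ^ n; \<eta>' = \<eta> * cis (twist_angle n d u) in (\<eta>' ^ n * disc_push d u, \<eta>'))"

lemma join_map_surj: "join_map ` (cball 0 1 \<times> circ) = S3C"
proof
  show "join_map ` (cball 0 1 \<times> circ) \<subseteq> S3C"
    by (auto simp: join_map_def norm_prod_def norm_mult power_mult_distrib abs_square_le_1)
  show "S3C \<subseteq> join_map ` (cball 0 1 \<times> circ)"
  proof
    fix p assume p: "p \<in> S3C"
    obtain z w where zw: "p = (z, w)" by (cases p)
    have eq: "(cmod z)\<^sup>2 + (cmod w)\<^sup>2 = 1" using p zw mem_S3C by simp
    then have "(cmod w)\<^sup>2 \<le> 1\<^sup>2"
      by (smt (verit) one_power2 zero_le_power2)
    then have w: "cmod w \<le> 1" by (rule power2_le_imp_le) simp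
    have z: "sqrt (1 - (cmod w)\<^sup>2) = cmod z"
      using eq by (intro real_sqrt_unique) auto
    define \<eta> where "\<eta> = (if z = 0 then 1 else sgn z)"
    have "of_real (cmod z) * \<eta> = z" "cmod \<eta> = 1"
      by (auto simp: \<eta>_def norm_sgn sgn_eq norm_divide)
    then show "p \<in> join_map ` (cball 0 1 \<times> circ)"
      using w z zw by (intro image_eqI[of _ _ "(w, \<eta>)"]) (auto simp: join_map_def)
  qed
qed

lemma join_map_eq_iff:
  assumes "cmod y \<le> 1" "cmod y' \<le> 1"
  shows "join_map (y, \<eta>) = join_map (y', \<eta>') \<longleftrightarrow> y = y' \<and> (cmod y = 1 \<or> \<eta> = \<eta>')"
  using assms by (auto simp: join_map_def power2_eq_1_iff) (smt (verit) norm_ge_zero)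

lemma continuous_join_map: "continuous_on X join_map"
  unfolding join_map_def case_prod_beta by (intro continuous_intros)

context
  fixes d :: real and n :: nat
  assumes d: "0 < d" "d \<le> 1/20"
begin

lemma continuous_braid_map: "continuous_on (cball 0 1 \<times> circ) (braid_map n d)"
proof -
  have u: "continuous_on (cball 0 1 \<times> circ) (\<lambda>p. fst p / snd p ^ n :: complex)"
    by (intro continuous_intros) auto
  have "continuous_on (cball 0 1 \<times> circ) (\<lambda>p. twist_angle n d (fst p / snd p ^ n))"
    by (rule continuous_on_compose2[OF continuous_twist_angle[OF d, of UNIV] u]) auto
  moreover have "continuous_on (cball 0 1 \<times> circ) (\<lambda>p. disc_push d (fst p / snd p ^ n))"
    by (rule continuous_on_compose2[OF continuous_disc_push[OF d, of UNIV] u]) auto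
  ultimately show ?thesis
    unfolding braid_map_def case_prod_beta Let_def cis_conv_exp
    by (intro continuous_intros)
qed

lemma braid_map_boundary: "cmod y = 1 \<Longrightarrow> cmod \<eta> = 1 \<Longrightarrow> braid_map n d (y, \<eta>) = (y, \<eta>)"
  using disc_push_boundary[OF d, of "y / \<eta> ^ n"] twist_angle_boundary[of "y / \<eta> ^ n" n d]
  by (auto simp: braid_map_def norm_divide norm_power)

lemma braid_map_norm:
  assumes "cmod y \<le> 1" "cmod \<eta> = 1"
  shows "cmod (snd (braid_map n d (y, \<eta>))) = 1" "cmod (fst (braid_map n d (y, \<eta>))) \<le> 1"
    "cmod (fst (braid_map n d (y, \<eta>))) = 1 \<longleftrightarrow> cmod y = 1"
proof -
  let ?u = "y / \<eta> ^ n"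
  have u: "cmod ?u = cmod y" using assms by (simp add: norm_divide norm_power)
  show "cmod (snd (braid_map n d (y, \<eta>))) = 1"
    using assms by (simp add: braid_map_def Let_def norm_mult)
  have f: "cmod (fst (braid_map n d (y, \<eta>))) = cmod (disc_push d ?u)"
    using assms by (simp add: braid_map_def Let_def norm_mult norm_power)
  show "cmod (fst (braid_map n d (y, \<eta>))) \<le> 1"
    "cmod (fst (braid_map n d (y, \<eta>))) = 1 \<longleftrightarrow> cmod y = 1"
    using disc_push_interior[OF d, of ?u] disc_push_boundary[OF d, of ?u] u assms f
    by (cases "cmod y = 1"; force)+
qed

lemma inj_braid_map: "inj_on (braid_map n d) (cball 0 1 \<times> circ)"
proof (clarsimp simp: inj_on_def)
  fix y \<eta> y' \<eta>' :: complex
  assume y: "cmod y \<le> 1" "cmod y' \<le> 1" and \<eta>: "cmod \<eta> = 1" "cmod \<eta>' = 1"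
    and eq: "braid_map n d (y, \<eta>) = braid_map n d (y', \<eta>')"
  let ?u = "y / \<eta> ^ n" and ?u' = "y' / \<eta>' ^ n"
  have nz: "\<eta> \<noteq> 0" "\<eta>' \<noteq> 0" using \<eta> by auto
  have 2: "\<eta> * cis (twist_angle n d ?u) = \<eta>' * cis (twist_angle n d ?u')"
    using eq by (simp add: braid_map_def Let_def)
  then have "disc_push d ?u = disc_push d ?u'"
    using eq nz by (simp add: braid_map_def Let_def)
  then have u: "?u = ?u'"
    by (rule inj_onD[OF inj_disc_push[OF d]]) (use y \<eta> in \<open>simp_all add: norm_divide norm_power\<close>)
  then have "\<eta> = \<eta>'" using 2 by simp
  then show "y = y' \<and> \<eta> = \<eta>'" using u nz by simp
qed

lemma braid_map_preimage:
  assumes u: "cmod u \<le> 1" and \<eta>: "cmod \<eta> = 1"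
  defines "\<xi> \<equiv> \<eta> * cis (- twist_angle n d u)"
  shows "cmod \<xi> = 1" "braid_map n d (\<xi> ^ n * u, \<xi>) = (\<eta> ^ n * disc_push d u, \<eta>)"
proof -
  show "cmod \<xi> = 1" using \<eta> by (simp add: \<xi>_def norm_mult)
  then have "\<xi> \<noteq> 0" by auto
  moreover have "\<xi> * cis (twist_angle n d u) = \<eta>"
    by (simp add: \<xi>_def mult.assoc cis_mult)
  ultimately show "braid_map n d (\<xi> ^ n * u, \<xi>) = (\<eta> ^ n * disc_push d u, \<eta>)"
    by (simp add: braid_map_def Let_def)
qed

lemma braid_map_surj: "braid_map n d ` (cball 0 1 \<times> circ) = cball 0 1 \<times> circ"
proof
  show "braid_map n d ` (cball 0 1 \<times> circ) \<subseteq> cball 0 1 \<times> circ"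
  proof (rule image_subsetI)
    fix p :: "complex \<times> complex" assume "p \<in> cball 0 1 \<times> circ"
    then show "braid_map n d p \<in> cball 0 1 \<times> circ"
      using braid_map_norm[of "fst p" "snd p"] by (simp add: mem_Times_iff)
  qed
  show "cball 0 1 \<times> circ \<subseteq> braid_map n d ` (cball 0 1 \<times> circ)"
  proof clarify
    fix x \<eta> :: complex assume x: "x \<in> cball 0 1" and \<eta>: "\<eta> \<in> circ"
    then have "x / \<eta> ^ n \<in> disc_push d ` cball 0 1"
      unfolding disc_push_cball[OF d] by (simp add: norm_divide norm_power)
    then obtain u where u: "cmod u \<le> 1" "x / \<eta> ^ n = disc_push d u" by auto
    let ?\<xi> = "\<eta> * cis (- twist_angle n d u)"
    have "\<eta> \<noteq> 0" using \<eta> by auto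
    then have "\<eta> ^ n * disc_push d u = x" by (simp flip: u(2))
    then have "braid_map n d (?\<xi> ^ n * u, ?\<xi>) = (x, \<eta>)" "cmod ?\<xi> = 1"
      using braid_map_preimage[OF u(1), of \<eta>] \<eta> by auto
    then show "(x, \<eta>) \<in> braid_map n d ` (cball 0 1 \<times> circ)"
      using u(1) by (intro image_eqI[of _ _ "(?\<xi> ^ n * u, ?\<xi>)"]) (auto simp: norm_mult norm_power)
  qed
qed

text \<open>The map on \<open>disc \<times> circle\<close> descends to the quotient because it is bijective and is the identity over
  the boundary of the disc, so it identifies exactly the points that \<open>join_map\<close> identifies.\<close>
lemma cabling_homeomorphism_exists:
  "\<exists>\<phi> \<phi>'. homeomorphism S3C S3C \<phi> \<phi>' \<and>
    (\<forall>p \<in> cball 0 1 \<times> circ. \<phi> (join_map p) = prod.swap (join_map (braid_map n d p)))"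
proof -
  let ?A = "cball 0 1 \<times> circ :: (complex \<times> complex) set"
  let ?h = "\<lambda>p. prod.swap (join_map (braid_map n d p))"
  have swap: "prod.swap ` S3C = S3C"
  proof -
    have "prod.swap p \<in> S3C" if "p \<in> S3C" for p
      using that by (cases p) (simp add: norm_prod_def add.commute)
    then show ?thesis by (metis imageI image_subsetI subsetI subset_antisym swap_swap)
  qed
  have him: "?h ` ?A = S3C"
  proof -
    have "?h ` ?A = prod.swap ` join_map ` braid_map n d ` ?A" by (simp only: image_image)
    then show ?thesis by (simp only: braid_map_surj join_map_surj swap)
  qed
  have cont: "continuous_on ?A ?h"
    unfolding prod.swap_def
    by (intro continuous_intros continuous_on_compose2[OF continuous_join_map continuous_braid_map subset_UNIV])
  have cA: "compact ?A" by (intro compact_Times compact_cball compact_sphere)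
  have q: "quotient_map (top_of_set ?A) (top_of_set S3C) join_map"
    using cA join_map_surj continuous_join_map
    by (intro continuous_imp_quotient_map)
      (auto simp: Hausdorff_space_subtopology compact_space_subtopology)
  have fib: "?h p = ?h p' \<longleftrightarrow> join_map p = join_map p'" if p: "p \<in> ?A" "p' \<in> ?A" for p p'
  proof -
    obtain y \<eta> y' \<eta>' where [simp]: "p = (y, \<eta>)" "p' = (y', \<eta>')" by (cases p, cases p')
    have n: "cmod y \<le> 1" "cmod \<eta> = 1" "cmod y' \<le> 1" "cmod \<eta>' = 1" using p by auto
    have "?h p = ?h p' \<longleftrightarrow> join_map (braid_map n d p) = join_map (braid_map n d p')"
      by (metis swap_swap)
    also have "\<dots> \<longleftrightarrow> fst (braid_map n d p) = fst (braid_map n d p') \<and>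
        (cmod (fst (braid_map n d p)) = 1 \<or> snd (braid_map n d p) = snd (braid_map n d p'))"
      using braid_map_norm(2)[of y \<eta>] braid_map_norm(2)[of y' \<eta>'] n
        join_map_eq_iff[of "fst (braid_map n d p)" "fst (braid_map n d p')"
          "snd (braid_map n d p)" "snd (braid_map n d p')"] by simp
    also have "\<dots> \<longleftrightarrow> y = y' \<and> (cmod y = 1 \<or> \<eta> = \<eta>')"
    proof (cases "cmod y = 1 \<or> cmod y' = 1")
      case True
      then show ?thesis
        using braid_map_norm[of y \<eta>] braid_map_norm[of y' \<eta>'] braid_map_boundary[of y \<eta>]
          braid_map_boundary[of y' \<eta>'] n by auto
    next
      case False
      then have "braid_map n d p = braid_map n d p' \<longleftrightarrow> p = p'"
        using inj_onD[OF inj_braid_map] p by metis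
      then show ?thesis using False braid_map_norm[of y \<eta>] n by (auto simp: prod_eq_iff)
    qed
    also have "\<dots> \<longleftrightarrow> join_map p = join_map p'" using n by (simp add: join_map_eq_iff)
    finally show ?thesis .
  qed
  obtain \<phi> where \<phi>: "continuous_map (top_of_set S3C) (top_of_set S3C) \<phi>"
    "\<phi> ` topspace (top_of_set S3C) = ?h ` topspace (top_of_set ?A)"
    "\<And>p. p \<in> topspace (top_of_set ?A) \<Longrightarrow> \<phi> (join_map p) = ?h p"
  proof (rule quotient_map_lift_exists[OF q])
    show "continuous_map (top_of_set ?A) (top_of_set S3C) ?h"
      using cont him by auto
  qed (use fib in auto)
  have \<phi>E: "\<phi> (join_map p) = ?h p" if "p \<in> ?A" for p using \<phi>(3) that by simp
  have inj: "inj_on \<phi> S3C"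
  proof (rule inj_onI)
    fix a b assume ab: "a \<in> S3C" "b \<in> S3C" "\<phi> a = \<phi> b"
    then obtain p p' where "p \<in> ?A" "p' \<in> ?A" "a = join_map p" "b = join_map p'"
      unfolding join_map_surj[symmetric] by auto
    then show "a = b" using ab \<phi>E fib by metis
  qed
  have "\<phi> ` S3C = S3C" using \<phi>(2) him by simp
  moreover have "continuous_on S3C \<phi>" using \<phi>(1) by simp
  ultimately obtain \<phi>' where "homeomorphism S3C S3C \<phi> \<phi>'"
    using homeomorphism_compact[OF compact_sphere _ _ inj] by blast
  then show ?thesis using \<phi>E by blast
qed

end

definition std_torus :: "complex \<times> complex \<Rightarrow> complex \<times> complex" where
  "std_torus = (\<lambda>(\<zeta>, v). join_map (4/5 * v, \<zeta>))"

lemma cis_minus_Arg: "cis (- Arg z) * z = of_real (cmod z)"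
proof -
  have "cis (- Arg z) * rcis (cmod z) (Arg z) = of_real (cmod z)"
    by (simp add: rcis_def mult.left_commute cis_mult)
  then show ?thesis by (simp only: rcis_cmod_Arg)
qed

text \<open>The map \<open>f\<close> is \<open>\<phi>\<close> read in the parametrization of the standard torus. It maps meridian discs into
  meridian discs, wraps the core \<open>n\<close> times around, and has images of meridian discs as small as
  desired. The last clause says that the core of the complementary torus links the image
  torus \<open>n\<close> times.\<close>
lemma cabling:
  assumes n: "n \<ge> 1" and e: "0 < e"
  obtains \<phi> \<phi>' f a k where
    "homeomorphism S3C S3C \<phi> \<phi>'"
    "\<And>p. p \<in> solid_torus \<Longrightarrow> \<phi> (std_torus p) = std_torus (f p)"
    "\<And>\<zeta> v. (\<zeta>, v) \<in> solid_torus \<Longrightarrow> fst (f (\<zeta>, v)) = \<zeta> ^ n"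
    "\<And>p. p \<in> solid_torus \<Longrightarrow> snd (f p) \<in> ball 0 1"
    "0 < a" "a < (1::real)" "\<And>\<zeta>. \<zeta> \<in> circ \<Longrightarrow> f (\<zeta>, 0) = (\<zeta> ^ n, of_real a * \<zeta>)"
    "\<And>\<zeta> v v'. (\<zeta>, v) \<in> solid_torus \<Longrightarrow> (\<zeta>, v') \<in> solid_torus \<Longrightarrow> dist (f (\<zeta>, v)) (f (\<zeta>, v')) < e"
    "\<And>\<eta>. \<eta> \<in> circ \<Longrightarrow> snd (\<phi>' (0, \<eta>)) = k * \<eta> ^ n"
proof -
  \<comment> \<open>\<open>Q y\<close> is the position in its meridian disc of the point that is pushed to \<open>y\<close>, relative
    to the direction of \<open>\<zeta>\<close>. As the pushed torus shrinks to \<open>core_offset\<close>, these positions tend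
    to a limit, which makes the discs thin.\<close>
  define Q where "Q = (\<lambda>y. of_real (5/4 * sqrt (1 - (cmod y)\<^sup>2)) * cis (- Arg y / n))"
  have Qc: "isCont Q (of_real core_offset)"
  proof -
    have "isCont Arg (of_real core_offset)"
      by (rule continuous_at_Arg) (auto simp: complex_nonpos_Reals_iff core_offset_def)
    then show ?thesis unfolding Q_def cis_conv_exp divide_inverse[of _ "real n"]
      by (intro continuous_intros) auto
  qed
  then obtain r where r: "0 < r" "\<And>y. dist y (of_real core_offset) < r \<Longrightarrow> dist (Q y) (Q (of_real core_offset)) < e / 2"
    using Qc[unfolded continuous_at_eps_delta, rule_format, OF half_gt_zero[OF e]] by auto
  define d where "d = min (1/20) (r/3)"
  have d: "0 < d" "d \<le> 1/20" "2 * d < r" using r by (auto simp: d_def)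
  define f where "f = (\<lambda>(\<zeta>, v). (\<zeta> ^ n :: complex, \<zeta> * Q (disc_push d (4/5 * v / \<zeta> ^ n))))"
  obtain \<phi> \<phi>' where \<phi>: "homeomorphism S3C S3C \<phi> \<phi>'"
    "\<And>p. p \<in> cball 0 1 \<times> circ \<Longrightarrow> \<phi> (join_map p) = prod.swap (join_map (braid_map n d p))"
    using cabling_homeomorphism_exists[OF d(1,2), of n] by blast
  have u: "cmod (4/5 * v / \<zeta> ^ n) \<le> 4/5" if "(\<zeta>, v) \<in> solid_torus" for \<zeta> v
    using that by (simp add: norm_mult norm_divide norm_power)
  have G: "3/5 < Re (disc_push d (4/5 * v / \<zeta> ^ n))" "3/5 < cmod (disc_push d (4/5 * v / \<zeta> ^ n))"
    "cmod (disc_push d (4/5 * v / \<zeta> ^ n)) < 1"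
    "dist (disc_push d (4/5 * v / \<zeta> ^ n)) (of_real core_offset) < r"
    if "(\<zeta>, v) \<in> solid_torus" for \<zeta> v
  proof -
    note low = disc_push_low[OF d(1,2) u[OF that]]
    show 1: "3/5 < Re (disc_push d (4/5 * v / \<zeta> ^ n))"
      unfolding low by (rule small_disc_right[OF d(1,2) u[OF that]])
    then show "3/5 < cmod (disc_push d (4/5 * v / \<zeta> ^ n))"
      using complex_Re_le_cmod by (rule less_le_trans)
    show "cmod (disc_push d (4/5 * v / \<zeta> ^ n)) < 1"
      using u[OF that] by (intro disc_push_interior[OF d(1,2)]) linarith
    show "dist (disc_push d (4/5 * v / \<zeta> ^ n)) (of_real core_offset) < r"
      unfolding low dist_norm using small_disc_near[OF d(1,2) u[OF that]] d by linarith
  qed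
  define a where "a = 5/4 * sqrt (1 - ((1 - d) * core_offset)\<^sup>2)"
  have sq: "((1 - d) * core_offset)\<^sup>2 < 1\<^sup>2" "(3/5)\<^sup>2 < ((1 - d) * core_offset)\<^sup>2"
    using d by (intro power_strict_mono; simp add: core_offset_def)+
  \<comment> \<open>The preimage of the core \<open>z = 0\<close> of the complementary torus.\<close>
  obtain u0 where u0: "cmod u0 \<le> 1" "disc_push d u0 = 0"
    using disc_push_cball[OF d(1,2)] by (metis centre_in_cball imageE mem_cball_0 zero_le_one)
  define k where "k = cis (- n * twist_angle n d u0) * u0"
  show ?thesis
  proof (rule that[OF \<phi>(1)])
    fix p assume p: "p \<in> solid_torus"
    obtain \<zeta> v where zv: "p = (\<zeta>, v)" by (cases p)
    note p = p[unfolded zv] note Gp = G[OF p]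
    let ?u = "4/5 * v / \<zeta> ^ n" let ?g = "disc_push d ?u"
    have g0: "?g \<noteq> 0" using Gp by auto
    have tw: "twist_angle n d ?u = - Arg ?g / n" by (rule twist_angle_low[OF d(1,2) u[OF p]])
    have "cis (- Arg ?g / n) ^ n * ?g = of_real (cmod ?g)"
    proof -
      have "cis (- Arg ?g / n) ^ n = cis (- Arg ?g)" using n Complex.DeMoivre[of "- Arg ?g / n" n] by simp
      then show ?thesis by (simp only: cis_minus_Arg)
    qed
    then have "braid_map n d (4/5 * v, \<zeta>) = (\<zeta> ^ n * of_real (cmod ?g), \<zeta> * cis (- Arg ?g / n))"
      by (simp only: braid_map_def Let_def case_prod_conv tw power_mult_distrib mult.assoc)
    then have "\<phi> (std_torus p) =
        (\<zeta> ^ n * of_real (cmod ?g), of_real (sqrt (1 - (cmod ?g)\<^sup>2)) * (\<zeta> * cis (- Arg ?g / n)))"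
      using \<phi>(2)[of "(4/5 * v, \<zeta>)"] p
      by (simp add: zv std_torus_def join_map_def norm_mult norm_power)
    moreover have sG: "(cmod ?g)\<^sup>2 < 1\<^sup>2" using Gp by (intro power_strict_mono) auto
    have "std_torus (f p) =
        (\<zeta> ^ n * of_real (cmod ?g), of_real (sqrt (1 - (cmod ?g)\<^sup>2)) * (\<zeta> * cis (- Arg ?g / n)))"
      using sG p by (simp add: zv f_def std_torus_def join_map_def Q_def norm_mult norm_power)
    ultimately show "\<phi> (std_torus p) = std_torus (f p)" by simp
    show "snd (f p) \<in> ball 0 1"
    proof -
      have "(3/5)\<^sup>2 < (cmod ?g)\<^sup>2" using Gp by (intro power_strict_mono) auto
      then have "1 - (cmod ?g)\<^sup>2 < (4/5)\<^sup>2" unfolding power_divide by simp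
      then have "sqrt (1 - (cmod ?g)\<^sup>2) < 4/5" by (intro real_less_lsqrt) auto
      then show ?thesis using p sG by (simp add: zv f_def Q_def norm_mult)
    qed
  next
    fix \<zeta> v :: complex show "fst (f (\<zeta>, v)) = \<zeta> ^ n" by (simp add: f_def)
  next
    show "0 < a" using sq by (simp add: a_def)
    have "1 - ((1 - d) * core_offset)\<^sup>2 < (4/5)\<^sup>2" using sq(2) unfolding power_divide by simp
    then have "sqrt (1 - ((1 - d) * core_offset)\<^sup>2) < 4/5" by (intro real_less_lsqrt) auto
    then show "a < 1" by (simp add: a_def)
  next
    fix \<zeta> :: complex
    have "disc_push d 0 = of_real ((1 - d) * core_offset)" using disc_push_low[OF d(1,2), of 0] by simp
    moreover have "Q (of_real ((1 - d) * core_offset)) = of_real a"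
      unfolding Q_def a_def norm_of_real power2_abs Arg_of_real using d by (simp add: core_offset_def)
    ultimately show "f (\<zeta>, 0) = (\<zeta> ^ n, of_real a * \<zeta>)" by (simp add: f_def mult.commute)
  next
    fix \<zeta> v v' assume v: "(\<zeta>, v) \<in> solid_torus" "(\<zeta>, v') \<in> solid_torus"
    let ?q = "\<lambda>v. Q (disc_push d (4/5 * v / \<zeta> ^ n))"
    have "dist (f (\<zeta>, v)) (f (\<zeta>, v')) = dist (?q v) (?q v')"
      using v by (simp add: f_def dist_prod_def dist_norm norm_mult flip: right_diff_distrib)
    also have "\<dots> < e"
      using r(2)[OF G(4)[OF v(1)]] r(2)[OF G(4)[OF v(2)]]
      by (rule dist_triangle_half_l)
    finally show "dist (f (\<zeta>, v)) (f (\<zeta>, v')) < e" .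
  next
    fix \<eta> :: complex assume \<eta>: "\<eta> \<in> circ"
    let ?\<xi> = "\<eta> * cis (- twist_angle n d u0)"
    have 1: "cmod ?\<xi> = 1" "braid_map n d (?\<xi> ^ n * u0, ?\<xi>) = (0, \<eta>)"
      using braid_map_preimage[OF d(1,2) u0(1), of \<eta> n] \<eta> u0(2) by auto
    have in_A: "(?\<xi> ^ n * u0, ?\<xi>) \<in> cball 0 1 \<times> circ"
      using 1 u0(1) by (simp add: norm_mult norm_power)
    have "\<phi> (join_map (?\<xi> ^ n * u0, ?\<xi>)) = (0, \<eta>)"
      using \<phi>(2)[OF in_A] 1(2) by (simp add: join_map_def)
    moreover have "join_map (?\<xi> ^ n * u0, ?\<xi>) \<in> S3C" using join_map_surj in_A by blast
    ultimately have "\<phi>' (0, \<eta>) = join_map (?\<xi> ^ n * u0, ?\<xi>)"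
      using \<phi>(1) by (metis homeomorphism_apply1)
    then have "snd (\<phi>' (0, \<eta>)) = (\<eta> * cis (- twist_angle n d u0)) ^ n * u0"
      by (simp add: join_map_def)
    also have "\<dots> = k * \<eta> ^ n"
      by (simp add: power_mult_distrib k_def Complex.DeMoivre)
    finally show "snd (\<phi>' (0, \<eta>)) = k * \<eta> ^ n" .
  qed
qed

section \<open>Tameness of the standard solid torus\<close>

lemma std_torus_image: "std_torus ` solid_torus = {p \<in> S3C. cmod (snd p) \<le> 4/5}"
proof
  show "std_torus ` solid_torus \<subseteq> {p \<in> S3C. cmod (snd p) \<le> 4/5}"
  proof (rule image_subsetI)
    fix p :: "complex \<times> complex" assume "p \<in> solid_torus"
    then obtain \<zeta> v where p: "p = (\<zeta>, v)" "\<zeta> \<in> circ" "v \<in> cball 0 1" by auto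
    then have "(4/5 * v, \<zeta>) \<in> cball 0 1 \<times> circ" by (simp add: norm_mult)
    then have "join_map (4/5 * v, \<zeta>) \<in> S3C" using join_map_surj by blast
    then show "std_torus p \<in> {p \<in> S3C. cmod (snd p) \<le> 4/5}"
      using p by (simp add: std_torus_def join_map_def norm_mult)
  qed
  show "{p \<in> S3C. cmod (snd p) \<le> 4/5} \<subseteq> std_torus ` solid_torus"
  proof clarify
    fix z w assume zw: "(z, w) \<in> S3C" "cmod (snd (z, w)) \<le> 4/5"
    then obtain y \<eta> where y: "(z, w) = join_map (y, \<eta>)" "cmod y \<le> 1" "cmod \<eta> = 1"
      using join_map_surj by fastforce
    then have yw: "join_map (w, \<eta>) = (z, w)" by (simp add: join_map_def)
    then show "(z, w) \<in> std_torus ` solid_torus"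
      using y(3) zw(2) by (intro image_eqI[of _ _ "(\<eta>, 5/4 * w)"])
        (simp_all add: std_torus_def norm_mult yw)
  qed
qed

text \<open>Stereographic projection from \<open>(0, 1)\<close>, a point of the complement of the standard torus. It maps
  the torus to the solid torus of revolution with radii \<open>5/3\<close> and \<open>4/3\<close>. Two further homeomorphisms
  of space make this polyhedral: one turns the circles around the axis into squares, and one turns
  the round cross-sections into diamonds.\<close>
definition stereo :: "complex \<times> complex \<Rightarrow> complex \<times> real" where
  "stereo = (\<lambda>(z, w). (z / of_real (1 - Re w), Im w / (1 - Re w)))"

definition stereo_inv :: "complex \<times> real \<Rightarrow> complex \<times> complex" where
  "stereo_inv = (\<lambda>(y, t). let s = (cmod y)\<^sup>2 + t\<^sup>2 in
     (of_real (2 / (s + 1)) * y, of_real ((s - 1) / (s + 1)) + \<i> * of_real (2 * t / (s + 1))))"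

lemma stereo_homeomorphism: "homeomorphism (S3C - {(0, 1)}) UNIV stereo stereo_inv"
proof (rule homeomorphismI)
  have ne: "1 - Re w > 0" if "(z, w) \<in> S3C - {(0, 1)}" for z w
  proof -
    have 1: "(cmod z)\<^sup>2 + (cmod w)\<^sup>2 = 1" using that mem_S3C by simp
    then have 2: "(cmod z)\<^sup>2 + (Re w)\<^sup>2 + (Im w)\<^sup>2 = 1" by (simp add: cmod_power2)
    have le: "(Re w)\<^sup>2 \<le> 1\<^sup>2" using 2 by (smt (verit) one_power2 zero_le_power2)
    then have "\<bar>Re w\<bar> \<le> 1" by (metis abs_one abs_le_square_iff)
    moreover have "Re w \<noteq> 1"
    proof
      assume "Re w = 1"
      then have "(cmod z)\<^sup>2 + (Im w)\<^sup>2 = 0" using 2 by simp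
      then have "z = 0" "Im w = 0" by (auto simp: add_nonneg_eq_0_iff)
      then show False using that \<open>Re w = 1\<close> by (simp add: complex_eq_iff)
    qed
    ultimately show ?thesis by simp
  qed
  have sp: "(cmod y)\<^sup>2 + t\<^sup>2 + 1 > 0" for y t
    by (smt (verit) zero_le_power2)
  show "continuous_on (S3C - {(0, 1)}) stereo"
    unfolding stereo_def case_prod_beta
    by (intro continuous_intros) (use ne in \<open>force simp: complex_eq_iff\<close>)+
  show "continuous_on UNIV stereo_inv"
    unfolding stereo_inv_def case_prod_beta Let_def
    by (intro continuous_intros ballI) (use sp in \<open>simp_all add: less_imp_neq[symmetric]\<close>)
  show "stereo ` (S3C - {(0, 1)}) \<subseteq> UNIV" by simp
  show "stereo_inv ` UNIV \<subseteq> S3C - {(0, 1)}"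
  proof (rule image_subsetI)
    fix p :: "complex \<times> real"
    obtain y t where p: "p = (y, t)" by (cases p)
    define s where "s = (cmod y)\<^sup>2 + t\<^sup>2"
    have s: "s + 1 > 0" unfolding s_def by (rule sp)
    have "(2 / (s + 1))\<^sup>2 * (cmod y)\<^sup>2 + (((s - 1) / (s + 1))\<^sup>2 + (2 * t / (s + 1))\<^sup>2)
        = (4 * s + (s - 1)\<^sup>2) / (s + 1)\<^sup>2"
      by (simp add: power_divide s_def add_divide_distrib power_mult_distrib algebra_simps)
    also have "\<dots> = 1" using s by (simp add: divide_simps) (simp add: power2_eq_square algebra_simps)
    finally have 1: "(2 / (s + 1))\<^sup>2 * (cmod y)\<^sup>2 + (((s - 1) / (s + 1))\<^sup>2 + (2 * t / (s + 1))\<^sup>2) = 1" .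
    have eq: "stereo_inv p = (of_real (2 / (s + 1)) * y, Complex ((s - 1) / (s + 1)) (2 * t / (s + 1)))"
      by (simp add: p stereo_inv_def s_def Let_def complex_eq_iff)
    have "stereo_inv p \<in> S3C"
      unfolding eq mem_S3C norm_mult norm_of_real power_mult_distrib power2_abs
      using 1 by (simp only: complex_norm real_sqrt_pow2 sum_power2_ge_zero)
    moreover have "(s - 1) / (s + 1) \<noteq> 1" using s by (simp add: divide_simps)
    then have "stereo_inv p \<noteq> (0, 1)" unfolding eq by (metis complex.sel(1) one_complex.sel(1) snd_conv)
    ultimately show "stereo_inv p \<in> S3C - {(0, 1)}" by simp
  qed
  show "stereo_inv (stereo p) = p" if "p \<in> S3C - {(0, 1)}" for p
  proof -
    obtain z w where p: "p = (z, w)" by (cases p)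
    define k where "k = 1 - Re w"
    have k: "k > 0" using ne that p by (simp add: k_def)
    have 2: "(cmod z)\<^sup>2 + (Im w)\<^sup>2 = k * (2 - k)"
      using that mem_S3C[of z w] unfolding p cmod_power2[of w]
      by (simp add: k_def power2_eq_square algebra_simps)
    define s where "s = (cmod (z / of_real k))\<^sup>2 + (Im w / k)\<^sup>2"
    have "s = ((cmod z)\<^sup>2 + (Im w)\<^sup>2) / k\<^sup>2"
      by (simp add: s_def norm_divide power_divide add_divide_distrib)
    then have s: "s = (2 - k) / k" 
      using k unfolding 2 by (simp add: power2_eq_square)
    then have s1: "s + 1 = 2 / k" "s - 1 = (2 - 2 * k) / k" using k unfolding s by (simp_all add: field_simps)
    have "stereo_inv (stereo p) = (of_real (2 / (s + 1)) * (z / of_real k),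
        of_real ((s - 1) / (s + 1)) + \<i> * of_real (2 * (Im w / k) / (s + 1)))"
      by (simp add: p stereo_def stereo_inv_def Let_def s_def k_def)
    also have "\<dots> = (z, w)"
      unfolding s1 using k by (simp add: complex_eq_iff) (simp add: k_def)
    finally show ?thesis by (simp add: p)
  qed
  show "stereo (stereo_inv q) = q" for q
  proof -
    obtain y t where q: "q = (y, t)" by (cases q)
    define s where "s = (cmod y)\<^sup>2 + t\<^sup>2"
    have s: "s + 1 > 0" unfolding s_def by (rule sp)
    have k: "1 - (s - 1) / (s + 1) = 2 / (s + 1)" using s by (simp add: divide_simps)
    have eq: "stereo_inv q = (of_real (2 / (s + 1)) * y, Complex ((s - 1) / (s + 1)) (2 * t / (s + 1)))"
      by (simp add: q stereo_inv_def s_def Let_def complex_eq_iff)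
    have "complex_of_real (s + 1) \<noteq> 0" using s by (simp only: of_real_eq_0_iff)
    then show ?thesis unfolding eq stereo_def case_prod_conv complex.sel k using s by (simp add: q)
  qed
qed

text \<open>On the sphere, \<open>|w| \<le> 4/5\<close> is \<open>|z| \<ge> 3/5\<close>, and \<open>|z| = 2 |y| / (|y|\<^sup>2 + t\<^sup>2 + 1)\<close>.\<close>
lemma stereo_torus:
  assumes "p \<in> S3C - {(0, 1)}" "stereo p = (y, t)"
  shows "cmod (snd p) \<le> 4/5 \<longleftrightarrow> (cmod y - 5/3)\<^sup>2 + t\<^sup>2 \<le> (4/3)\<^sup>2"
proof -
  define s where "s = (cmod y)\<^sup>2 + t\<^sup>2"
  have s: "s + 1 > 0" unfolding s_def by (smt (verit) zero_le_power2)
  have p: "p = stereo_inv (y, t)"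
    using assms stereo_homeomorphism by (metis homeomorphism_apply1)
  have "fst p = of_real (2 / (s + 1)) * y" by (simp add: p stereo_inv_def s_def Let_def)
  then have f: "cmod (fst p) = 2 * cmod y / (s + 1)"
    using s by (simp only: norm_mult norm_of_real) simp
  have "(cmod (fst p))\<^sup>2 + (cmod (snd p))\<^sup>2 = 1" using assms(1) mem_S3C[of "fst p" "snd p"] by simp
  then have "cmod (snd p) \<le> 4/5 \<longleftrightarrow> (3/5)\<^sup>2 \<le> (cmod (fst p))\<^sup>2"
    using abs_le_square_iff[of "cmod (snd p)" "4/5"] by (simp add: power_divide) linarith
  also have "\<dots> \<longleftrightarrow> 3/5 \<le> cmod (fst p)"
    using abs_le_square_iff[of "3/5" "cmod (fst p)"] by simp
  also have "\<dots> \<longleftrightarrow> 3 * (s + 1) \<le> 10 * cmod y" using s unfolding f by (simp add: divide_simps)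
  also have "\<dots> \<longleftrightarrow> (cmod y - 5/3)\<^sup>2 + t\<^sup>2 \<le> (4/3)\<^sup>2"
    by (simp add: s_def power2_eq_square algebra_simps) linarith
  finally show ?thesis .
qed

definition sup_norm :: "complex \<Rightarrow> real" where
  "sup_norm y = max \<bar>Re y\<bar> \<bar>Im y\<bar>"

lemma sup_norm_props:
  "0 \<le> sup_norm y" "sup_norm y = 0 \<longleftrightarrow> y = 0" "sup_norm (of_real r * y) = \<bar>r\<bar> * sup_norm y"
  "sup_norm y \<le> cmod y" "cmod y \<le> 2 * sup_norm y" "continuous_on X sup_norm"
proof -
  show "0 \<le> sup_norm y" "sup_norm y = 0 \<longleftrightarrow> y = 0"
    by (auto simp: sup_norm_def complex_eq_iff)
  show "sup_norm (of_real r * y) = \<bar>r\<bar> * sup_norm y"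
    by (simp add: sup_norm_def abs_mult max_mult_distrib_left)
  show "sup_norm y \<le> cmod y" by (simp add: sup_norm_def abs_Re_le_cmod abs_Im_le_cmod)
  show "cmod y \<le> 2 * sup_norm y" using cmod_le[of y] by (simp add: sup_norm_def)
  show "continuous_on X sup_norm" unfolding sup_norm_def by (intro continuous_intros)
qed

text \<open>Rescaling by a quotient that is undefined at the zeros of \<open>a\<close> is continuous there as well,
  since the numerator \<open>A\<close> vanishes there and \<open>c\<close> is bounded by a multiple of \<open>a\<close>.\<close>

lemma continuous_on_bounded_quotient:
  fixes c :: "'a::t2_space \<Rightarrow> 'b::real_normed_vector"
  assumes "continuous_on UNIV c" "continuous_on UNIV A" "continuous_on UNIV a"
    and pos: "\<And>x. 0 \<le> a x" and b: "\<And>x. norm (c x) \<le> K * a x" and z: "\<And>x. a x = 0 \<Longrightarrow> A x = 0"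
  shows "continuous_on UNIV (\<lambda>x. (A x / a x) *\<^sub>R c x)"
proof -
  have "isCont (\<lambda>x. (A x / a x) *\<^sub>R c x) x" for x
  proof (cases "a x = 0")
    case False
    then show ?thesis using assms(1-3)
      by (intro continuous_intros) (auto simp: continuous_on_eq_continuous_at)
  next
    case True
    have "isCont A x" using assms(2) by (simp add: continuous_on_eq_continuous_at)
    then have "((\<lambda>y. K * \<bar>A y\<bar>) \<longlongrightarrow> K * \<bar>A x\<bar>) (at x)"
      unfolding isCont_def by (intro tendsto_intros)
    then have lim: "((\<lambda>y. K * \<bar>A y\<bar>) \<longlongrightarrow> 0) (at x)"
      using z[OF True] by simp
    have bound: "norm ((A y / a y) *\<^sub>R c y) \<le> K * \<bar>A y\<bar>" for y
    proof (cases "a y = 0")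
      case False
      then have "a y > 0" using pos[of y] by simp
      moreover have "\<bar>A y\<bar> * norm (c y) \<le> \<bar>A y\<bar> * (K * a y)"
        using b[of y] by (intro mult_left_mono) auto
      ultimately show ?thesis by (simp add: divide_simps mult_ac)
    qed (simp add: z)
    have "((\<lambda>y. (A y / a y) *\<^sub>R c y) \<longlongrightarrow> 0) (at x)"
      using bound by (intro Lim_null_comparison[OF _ lim] always_eventually) blast
    then show ?thesis unfolding isCont_def using z[OF True] by simp
  qed
  then show ?thesis by (simp add: continuous_at_imp_continuous_on)
qed

text \<open>Rescaling every ray so that the Euclidean circles become squares.\<close>

definition to_square :: "complex \<Rightarrow> complex" where
  "to_square y = (cmod y / sup_norm y) *\<^sub>R y"

definition of_square :: "complex \<Rightarrow> complex" where
  "of_square y = (sup_norm y / cmod y) *\<^sub>R y"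

lemma sup_norm_to_square: "sup_norm (to_square y) = cmod y"
  using sup_norm_props(3)[of "cmod y / sup_norm y" y] sup_norm_props(1,2)[of y]
  by (cases "y = 0") (auto simp: to_square_def scaleR_conv_of_real)

lemma norm_of_square: "cmod (of_square y) = sup_norm y"
  by (simp add: of_square_def sup_norm_props)

lemma square_homeomorphism: "homeomorphism UNIV UNIV to_square of_square"
proof (rule homeomorphismI)
  show "continuous_on UNIV to_square"
    unfolding to_square_def
    by (rule continuous_on_bounded_quotient[where K = 2])
      (auto simp: sup_norm_props intro!: continuous_intros)
  show "continuous_on UNIV of_square"
    unfolding of_square_def
    by (rule continuous_on_bounded_quotient[where K = 1])
      (auto simp: sup_norm_props intro!: continuous_intros)
  show "of_square (to_square y) = y" for y
    unfolding of_square_def sup_norm_to_square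
    by (cases "y = 0") (auto simp: to_square_def sup_norm_props)
  show "to_square (of_square y) = y" for y
    unfolding to_square_def norm_of_square
    using sup_norm_props(3)[of "sup_norm y / cmod y" y]
    by (cases "y = 0") (auto simp: of_square_def sup_norm_props scaleR_conv_of_real)
qed auto

definition clamp_to :: "real \<Rightarrow> real \<Rightarrow> real" where
  "clamp_to a t = max (- a) (min a t)"

lemma clamp_to_id: "\<bar>t\<bar> \<le> a \<Longrightarrow> clamp_to a t = t"
  by (auto simp: clamp_to_def)

text \<open>The homeomorphism of the line that maps \<open>[-a, a]\<close> linearly onto \<open>[-b, b]\<close> and is a
  translation on either side of it. It is the identity for \<open>a = b = 0\<close>.\<close>

definition stretch :: "real \<Rightarrow> real \<Rightarrow> real \<Rightarrow> real" where
  "stretch a b t = t - clamp_to a t + (b / a) * clamp_to a t"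

lemma clamp_to_stretch:
  assumes "0 \<le> a" "0 \<le> b" "a = 0 \<longleftrightarrow> b = 0"
  shows "clamp_to b (stretch a b t) = (b / a) * clamp_to a t"
proof (cases "a = 0")
  case False
  then have ab: "a > 0" "b > 0" using assms by auto
  consider "t > a" | "t < - a" | "\<bar>t\<bar> \<le> a" by linarith
  then show ?thesis
  proof cases
    case 3
    then have c: "clamp_to a t = t" by (rule clamp_to_id)
    have "\<bar>(b / a) * t\<bar> = (b / a) * \<bar>t\<bar>" using ab by (simp add: abs_mult)
    also have "\<dots> \<le> (b / a) * a" using 3 ab by (intro mult_left_mono) auto
    finally have "\<bar>(b / a) * t\<bar> \<le> b" using ab by simp
    then have "clamp_to b ((b / a) * t) = (b / a) * t" by (rule clamp_to_id)
    then show ?thesis by (simp add: stretch_def c)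
  qed (use ab in \<open>auto simp: stretch_def clamp_to_def\<close>)
qed (use assms in \<open>simp add: clamp_to_def\<close>)

lemma stretch_inverse:
  assumes "0 \<le> a" "0 \<le> b" "a = 0 \<longleftrightarrow> b = 0"
  shows "stretch b a (stretch a b t) = t"
proof (cases "a = 0")
  case True
  then show ?thesis using assms by (simp add: stretch_def clamp_to_def)
next
  case False
  then show ?thesis unfolding stretch_def[of b] clamp_to_stretch[OF assms]
    using assms by (simp add: stretch_def)
qed

lemma abs_stretch_le_iff:
  assumes "0 \<le> a" "0 \<le> b" "a = 0 \<longleftrightarrow> b = 0"
  shows "\<bar>stretch a b t\<bar> \<le> b \<longleftrightarrow> \<bar>t\<bar> \<le> a"
proof -
  have c: "clamp_to a t = t \<longleftrightarrow> \<bar>t\<bar> \<le> a" if "0 \<le> a" for a t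
    using that by (auto simp: clamp_to_def)
  have "\<bar>stretch a b t\<bar> \<le> b \<longleftrightarrow> (b / a) * clamp_to a t = stretch a b t"
    using c[OF assms(2)] clamp_to_stretch[OF assms] by metis
  also have "\<dots> \<longleftrightarrow> clamp_to a t = t" by (auto simp: stretch_def)
  finally show ?thesis using c[OF assms(1)] by simp
qed

text \<open>Half the heights, at distance \<open>r\<close> from the axis, of a round cross-section with centre \<open>5/3\<close> and
  radius \<open>4/3\<close> and of the diamond inscribed in it. Since they vanish at the same places, stretching
  vertically by their quotient turns one into the other and does not move the axis.\<close>

definition round_height :: "real \<Rightarrow> real" where
  "round_height r = sqrt (max 0 ((4/3)\<^sup>2 - (r - 5/3)\<^sup>2))"

definition diamond_height :: "real \<Rightarrow> real" where
  "diamond_height r = max 0 (4/3 - \<bar>r - 5/3\<bar>)"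

lemma heights:
  "0 \<le> round_height r" "0 \<le> diamond_height r" "round_height r = 0 \<longleftrightarrow> diamond_height r = 0"
  "continuous_on X round_height" "continuous_on X diamond_height"
proof -
  show "0 \<le> round_height r" "0 \<le> diamond_height r"
    by (auto simp: round_height_def diamond_height_def)
  have "(4/3)\<^sup>2 \<le> (r - 5/3)\<^sup>2 \<longleftrightarrow> 4/3 \<le> \<bar>r - 5/3\<bar>"
    using abs_le_square_iff[of "4/3" "r - 5/3"] by simp
  then show "round_height r = 0 \<longleftrightarrow> diamond_height r = 0"
    by (auto simp: round_height_def diamond_height_def max_def simp del: power_divide)
  show "continuous_on X round_height" "continuous_on X diamond_height"
    unfolding round_height_def diamond_height_def by (intro continuous_intros)+
qed

lemma round_iff: "(r - 5/3)\<^sup>2 + t\<^sup>2 \<le> (4/3)\<^sup>2 \<longleftrightarrow> \<bar>r - 5/3\<bar> \<le> 4/3 \<and> \<bar>t\<bar> \<le> round_height r"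
proof -
  have 1: "(r - 5/3)\<^sup>2 \<le> (4/3)\<^sup>2 \<longleftrightarrow> \<bar>r - 5/3\<bar> \<le> 4/3"
    using abs_le_square_iff[of "r - 5/3" "4/3"] by simp
  have 2: "\<bar>t\<bar> \<le> sqrt X \<longleftrightarrow> t\<^sup>2 \<le> X" for X
    using real_sqrt_le_iff[of "t\<^sup>2" X] by simp
  show ?thesis
  proof (cases "(r - 5/3)\<^sup>2 \<le> (4/3)\<^sup>2")
    case True
    then have "max 0 ((4/3)\<^sup>2 - (r - 5/3)\<^sup>2) = (4/3)\<^sup>2 - (r - 5/3)\<^sup>2" by simp
    then show ?thesis unfolding round_height_def 2 using True 1 by (simp only:) argo
  next
    case False
    then show ?thesis using 1 by (smt (verit) zero_le_power2)
  qed
qed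

definition straighten :: "complex \<times> real \<Rightarrow> complex \<times> real" where
  "straighten = (\<lambda>(y, t). (to_square y, stretch (round_height (cmod y)) (diamond_height (cmod y)) t))"

definition unstraighten :: "complex \<times> real \<Rightarrow> complex \<times> real" where
  "unstraighten = (\<lambda>(y, t).
     (of_square y, stretch (diamond_height (sup_norm y)) (round_height (sup_norm y)) t))"

lemma continuous_stretch:
  assumes "continuous_on UNIV f" "continuous_on UNIV a" "continuous_on UNIV b"
    and "\<And>r. 0 \<le> a r" "\<And>r. 0 \<le> b r" "\<And>r. a r = 0 \<longleftrightarrow> b r = 0"
  shows "continuous_on UNIV (\<lambda>p :: complex \<times> real. stretch (a (f (fst p))) (b (f (fst p))) (snd p))"
proof -
  have f: "continuous_on UNIV (\<lambda>p :: complex \<times> real. f (fst p))"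
    by (rule continuous_on_compose2[OF assms(1)]) (auto intro: continuous_intros)
  have a: "continuous_on UNIV (\<lambda>p :: complex \<times> real. a (f (fst p)))"
    and b: "continuous_on UNIV (\<lambda>p :: complex \<times> real. b (f (fst p)))"
    by (rule continuous_on_compose2[OF assms(2) f] continuous_on_compose2[OF assms(3) f]; simp)+
  then have c: "continuous_on UNIV (\<lambda>p :: complex \<times> real. clamp_to (a (f (fst p))) (snd p))"
    unfolding clamp_to_def by (intro continuous_intros)
  have "continuous_on UNIV (\<lambda>p :: complex \<times> real.
      (b (f (fst p)) / a (f (fst p))) *\<^sub>R clamp_to (a (f (fst p))) (snd p))"
  proof (rule continuous_on_bounded_quotient[where K = 1, OF c b a])
    show "norm (clamp_to (a (f (fst p))) (snd p)) \<le> 1 * a (f (fst p))" for p :: "complex \<times> real"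
      using assms(4)[of "f (fst p)"] by (auto simp: clamp_to_def)
  qed (use assms in auto)
  then show ?thesis unfolding stretch_def real_scaleR_def
    by (intro continuous_on_add continuous_on_diff c continuous_on_snd continuous_on_id)
qed

lemma straighten_homeomorphism: "homeomorphism UNIV UNIV straighten unstraighten"
proof (rule homeomorphismI)
  note sq = square_homeomorphism[unfolded homeomorphism_def]
  have "continuous_on UNIV (\<lambda>p :: complex \<times> real. to_square (fst p))"
    by (rule continuous_on_compose2[of UNIV to_square]) (use sq in \<open>auto intro: continuous_intros\<close>)
  moreover have "continuous_on UNIV (\<lambda>p :: complex \<times> real.
      stretch (round_height (cmod (fst p))) (diamond_height (cmod (fst p))) (snd p))"
    by (rule continuous_stretch[OF continuous_on_norm_id heights(4,5,1,2,3)])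
  ultimately show "continuous_on UNIV straighten"
    unfolding straighten_def case_prod_beta by (rule continuous_on_Pair)
  have "continuous_on UNIV (\<lambda>p :: complex \<times> real. of_square (fst p))"
    by (rule continuous_on_compose2[of UNIV of_square]) (use sq in \<open>auto intro: continuous_intros\<close>)
  moreover have "continuous_on UNIV (\<lambda>p :: complex \<times> real.
      stretch (diamond_height (sup_norm (fst p))) (round_height (sup_norm (fst p))) (snd p))"
    by (rule continuous_stretch[OF sup_norm_props(6) heights(5,4,2,1) heights(3)[symmetric]])
  ultimately show "continuous_on UNIV unstraighten"
    unfolding unstraighten_def case_prod_beta by (rule continuous_on_Pair)
  show "unstraighten (straighten p) = p" "straighten (unstraighten p) = p" for p
    using sq by (auto simp: straighten_def unstraighten_def case_prod_beta sup_norm_to_square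
        norm_of_square stretch_inverse heights)
qed auto

definition diamond_torus :: "(complex \<times> real) set" where
  "diamond_torus = {(y, t). \<bar>sup_norm y - 5/3\<bar> + \<bar>t\<bar> \<le> 4/3}"

lemma straighten_torus: "straighten (y, t) \<in> diamond_torus \<longleftrightarrow> (cmod y - 5/3)\<^sup>2 + t\<^sup>2 \<le> (4/3)\<^sup>2"
proof -
  let ?r = "cmod y"
  have "\<bar>?r - 5/3\<bar> + \<bar>s\<bar> \<le> 4/3 \<longleftrightarrow> \<bar>?r - 5/3\<bar> \<le> 4/3 \<and> \<bar>s\<bar> \<le> diamond_height ?r" for s
    by (auto simp: diamond_height_def)
  then show ?thesis
    unfolding straighten_def diamond_torus_def mem_Collect_eq case_prod_conv sup_norm_to_square
      round_iff abs_stretch_le_iff[OF heights(1-3)[of ?r], symmetric] by blast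
qed

text \<open>The part of the torus over the plane sector with axis \<open>(\<alpha>, \<beta>)\<close> that is bounded by two diagonals.
  There the sup norm is linear, so the part is a convex polytope.\<close>
definition diamond_sector :: "real \<times> real \<Rightarrow> (complex \<times> real) set" where
  "diamond_sector = (\<lambda>(\<alpha>, \<beta>). {(y, t).
     \<bar>\<alpha> * Im y - \<beta> * Re y\<bar> \<le> \<alpha> * Re y + \<beta> * Im y \<and>
     \<bar>\<alpha> * Re y + \<beta> * Im y - 5/3\<bar> + \<bar>t\<bar> \<le> 4/3})"

abbreviation axis_directions :: "(real \<times> real) set" where
  "axis_directions \<equiv> {(1, 0), (-1, 0), (0, 1), (0, -1)}"

lemma diamond_torus_sectors: "diamond_torus = \<Union>(diamond_sector ` axis_directions)"
proof -
  have sup: "sup_norm y = \<alpha> * Re y + \<beta> * Im y"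
    if dir: "(\<alpha>, \<beta>) \<in> axis_directions"
      and le: "\<bar>\<alpha> * Im y - \<beta> * Re y\<bar> \<le> \<alpha> * Re y + \<beta> * Im y" for \<alpha> \<beta> y
  proof -
    consider "\<alpha> = 1" "\<beta> = 0" | "\<alpha> = -1" "\<beta> = 0" | "\<alpha> = 0" "\<beta> = 1" | "\<alpha> = 0" "\<beta> = -1"
      using dir by auto
    then show ?thesis using le unfolding sup_norm_def by cases ((simp; linarith)+)
  qed
  have dir: "\<exists>(\<alpha>, \<beta>) \<in> axis_directions. \<bar>\<alpha> * Im y - \<beta> * Re y\<bar> \<le> \<alpha> * Re y + \<beta> * Im y" for y
  proof -
    have "\<bar>Im y\<bar> \<le> Re y \<or> \<bar>Im y\<bar> \<le> - Re y \<or> \<bar>Re y\<bar> \<le> Im y \<or> \<bar>Re y\<bar> \<le> - Im y" by linarith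
    then show ?thesis by simp
  qed
  show ?thesis
  proof
    show "diamond_torus \<subseteq> \<Union>(diamond_sector ` axis_directions)"
    proof
      fix p assume p: "p \<in> diamond_torus"
      obtain \<alpha> \<beta> where d: "(\<alpha>, \<beta>) \<in> axis_directions"
        "\<bar>\<alpha> * Im (fst p) - \<beta> * Re (fst p)\<bar> \<le> \<alpha> * Re (fst p) + \<beta> * Im (fst p)"
        using dir[of "fst p"] by blast
      then have "p \<in> diamond_sector (\<alpha>, \<beta>)"
        using p sup[OF d] by (simp add: diamond_torus_def diamond_sector_def case_prod_beta)
      then show "p \<in> \<Union>(diamond_sector ` axis_directions)" using d(1) by blast
    qed
    show "\<Union>(diamond_sector ` axis_directions) \<subseteq> diamond_torus"
    proof
      fix p assume "p \<in> \<Union>(diamond_sector ` axis_directions)"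
      then obtain \<alpha> \<beta> where d: "(\<alpha>, \<beta>) \<in> axis_directions" and p: "p \<in> diamond_sector (\<alpha>, \<beta>)"
        by (metis UN_E surj_pair)
      have l: "\<bar>\<alpha> * Im (fst p) - \<beta> * Re (fst p)\<bar> \<le> \<alpha> * Re (fst p) + \<beta> * Im (fst p)"
        using p by (simp add: diamond_sector_def case_prod_beta)
      show "p \<in> diamond_torus"
        using p sup[OF d l] by (simp add: diamond_torus_def diamond_sector_def case_prod_beta)
    qed
  qed
qed

lemma polyhedron_halfspace_complex_real:
  "polyhedron {p :: complex \<times> real. u * Re (fst p) + v * Im (fst p) + w * snd p \<le> b}"
  using polyhedron_halfspace_le[of "(Complex u v, w)" b]
  by (simp add: inner_prod_def inner_complex_def)

lemma polytope_diamond_sector: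
  assumes "d \<in> axis_directions"
  shows "polytope (diamond_sector d)"
proof -
  obtain \<alpha> \<beta> where d: "d = (\<alpha>, \<beta>)" by (cases d)
  let ?H = "\<lambda>u v w b. {p :: complex \<times> real. u * Re (fst p) + v * Im (fst p) + w * snd p \<le> b}"
  have "diamond_sector d = ?H (- \<alpha> - \<beta>) (\<alpha> - \<beta>) 0 0 \<inter> ?H (\<beta> - \<alpha>) (- \<alpha> - \<beta>) 0 0 \<inter>
      ?H \<alpha> \<beta> 1 3 \<inter> ?H \<alpha> \<beta> (-1) 3 \<inter> ?H (- \<alpha>) (- \<beta>) 1 (-1/3) \<inter> ?H (- \<alpha>) (- \<beta>) (-1) (-1/3)"
  proof (rule Set.set_eqI)
    fix p
    have abs_sum: "\<bar>x\<bar> + \<bar>t\<bar> \<le> e \<longleftrightarrow> x + t \<le> e \<and> x - t \<le> e \<and> - x + t \<le> e \<and> - x - t \<le> e" for x t e :: real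
      by linarith
    show "p \<in> diamond_sector d \<longleftrightarrow> p \<in> ?H (- \<alpha> - \<beta>) (\<alpha> - \<beta>) 0 0 \<inter> ?H (\<beta> - \<alpha>) (- \<alpha> - \<beta>) 0 0 \<inter>
      ?H \<alpha> \<beta> 1 3 \<inter> ?H \<alpha> \<beta> (-1) 3 \<inter> ?H (- \<alpha>) (- \<beta>) 1 (-1/3) \<inter> ?H (- \<alpha>) (- \<beta>) (-1) (-1/3)"
      unfolding diamond_sector_def d case_prod_beta mem_Collect_eq Int_iff fst_conv snd_conv
        abs_le_iff abs_sum
      by (simp add: left_diff_distrib; linarith)
  qed
  then have "polyhedron (diamond_sector d)"
    by (simp only:) (intro polyhedron_Int polyhedron_halfspace_complex_real)
  moreover have "bounded (diamond_sector d)"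
  proof (rule bounded_subset)
    show "bounded (cball (0 :: complex) 6 \<times> cball (0 :: real) 2)"
      by (intro bounded_Times bounded_cball)
    have "diamond_sector d \<subseteq> diamond_torus" using assms unfolding diamond_torus_sectors by blast
    also have "\<dots> \<subseteq> cball 0 6 \<times> cball 0 2"
    proof
      fix p assume "p \<in> diamond_torus"
      then have le: "\<bar>sup_norm (fst p) - 5/3\<bar> + \<bar>snd p\<bar> \<le> 4/3"
        by (simp add: diamond_torus_def case_prod_beta)
      have "cmod (fst p) \<le> 6" using sup_norm_props(5)[of "fst p"] le by linarith
      moreover have "\<bar>snd p\<bar> \<le> 2" using le by linarith
      ultimately show "p \<in> cball 0 6 \<times> cball 0 2" by (simp add: mem_Times_iff)
    qed
    finally show "diamond_sector d \<subseteq> cball 0 6 \<times> cball 0 2" .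
  qed
  ultimately show ?thesis by (simp add: polytope_eq_bounded_polyhedron)
qed

lemma straightened_torus:
  defines "V \<equiv> std_torus ` solid_torus"
  shows "V \<subseteq> S3C - {(0, 1)}" "(straighten \<circ> stereo) ` V = diamond_torus"
    "homeomorphism (S3C - {(0, 1)}) UNIV (straighten \<circ> stereo) (stereo_inv \<circ> unstraighten)"
proof -
  let ?k = "straighten \<circ> stereo" and ?k' = "stereo_inv \<circ> unstraighten"
  show hom: "homeomorphism (S3C - {(0, 1)}) UNIV ?k ?k'"
    by (rule homeomorphism_compose[OF stereo_homeomorphism straighten_homeomorphism])
  show V: "V \<subseteq> S3C - {(0, 1)}" by (auto simp: V_def std_torus_image)
  have iff: "x \<in> V \<longleftrightarrow> ?k x \<in> diamond_torus" if x: "x \<in> S3C - {(0, 1)}" for x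
  proof -
    have "x \<in> V \<longleftrightarrow> cmod (snd x) \<le> 4/5" using x unfolding V_def std_torus_image by simp
    also have "\<dots> \<longleftrightarrow> ?k x \<in> diamond_torus"
      using stereo_torus[OF x, of "fst (stereo x)" "snd (stereo x)"]
        straighten_torus[of "fst (stereo x)" "snd (stereo x)"] by simp
    finally show ?thesis .
  qed
  show "?k ` V = diamond_torus"
  proof
    show "?k ` V \<subseteq> diamond_torus" using V iff by blast
    show "diamond_torus \<subseteq> ?k ` V"
    proof
      fix q assume q: "q \<in> diamond_torus"
      have "?k' q \<in> S3C - {(0, 1)}" using homeomorphism_image2[OF hom] by blast
      moreover have "?k (?k' q) = q" by (rule homeomorphism_apply2[OF hom]) simp
      ultimately show "q \<in> ?k ` V" using iff q by (metis imageI)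
    qed
  qed
qed

text \<open>Tameness is invariant under homeomorphisms of the sphere, so every image of the standard
  solid torus inherits it from the diamond torus.\<close>

lemma tame_standard_torus_image:
  assumes \<Psi>: "homeomorphism S3C S3 \<Psi> \<Psi>'"
  shows "tame (\<Psi> ` std_torus ` solid_torus)"
proof -
  have "DIM(complex \<times> real) = DIM(real^3)" by simp
  then obtain M :: "complex \<times> real \<Rightarrow> real^3" and M' where M: "linear M" "linear M'"
    "\<And>x. M' (M x) = x" "\<And>y. M (M' y) = y"
    using isomorphisms_UNIV_UNIV[where 'M = "complex \<times> real" and 'N = "real^3"] by metis
  have M_homeo: "homeomorphism UNIV UNIV M M'"
    using M by (intro homeomorphismI) (auto simp: linear_continuous_on linear_conv_bounded_linear)
  let ?V = "std_torus ` solid_torus"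
  define p where "p = (0 :: complex, 1 :: complex)"
  have p: "p \<in> S3C" by (simp add: p_def)
  note V = straightened_torus(1)[folded p_def]
  have inj: "inj_on \<Psi> S3C" using homeomorphism_apply1[OF \<Psi>] by (metis inj_onI)
  have im: "\<Psi> ` S3C = S3" using \<Psi> by (rule homeomorphism_image1)
  have "\<Psi> ` (S3C - {p}) = S3 - {\<Psi> p}"
    using inj_on_image_set_diff[OF inj, of S3C "{p}"] p im by simp
  then have "homeomorphism (S3C - {p}) (S3 - {\<Psi> p}) \<Psi> \<Psi>'"
    by (intro homeomorphism_of_subsets[OF \<Psi>]) auto
  then have 1: "homeomorphism (S3 - {\<Psi> p}) (S3C - {p}) \<Psi>' \<Psi>"
    by (rule homeomorphism_symD)
  define k where "k = M \<circ> (straighten \<circ> stereo)"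
  have g: "homeomorphism (S3 - {\<Psi> p}) UNIV (k \<circ> \<Psi>') (\<Psi> \<circ> ((stereo_inv \<circ> unstraighten) \<circ> M'))"
    unfolding k_def
    by (rule homeomorphism_compose[OF 1 homeomorphism_compose[OF
        straightened_torus(3)[folded p_def] M_homeo]])
  have "(k \<circ> \<Psi>') ` \<Psi> ` ?V = k ` (\<lambda>x. \<Psi>' (\<Psi> x)) ` ?V" by (simp only: image_image o_def)
  also have "(\<lambda>x. \<Psi>' (\<Psi> x)) ` ?V = (\<lambda>x. x) ` ?V"
    using V homeomorphism_apply1[OF \<Psi>] by (intro image_cong refl) blast
  also have "k ` (\<lambda>x. x) ` ?V = M ` (straighten \<circ> stereo) ` ?V"
    by (simp only: k_def image_image o_def)
  also have "\<dots> = \<Union>((\<lambda>d. M ` diamond_sector d) ` axis_directions)"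
    unfolding straightened_torus(2) diamond_torus_sectors by (simp only: image_Union image_image)
  finally have eq: "(k \<circ> \<Psi>') ` \<Psi> ` ?V = \<Union>((\<lambda>d. M ` diamond_sector d) ` axis_directions)" .
  have "\<Psi> p \<notin> \<Psi> ` ?V" using inj_on_image_mem_iff[OF inj p, of ?V] V by blast
  then have "\<Psi> p \<in> S3 - \<Psi> ` ?V" using p im by blast
  moreover have "\<Psi> ` ?V \<subseteq> S3" using V im by blast
  moreover have "\<forall>c \<in> (\<lambda>d. M ` diamond_sector d) ` axis_directions. polytope c"
    using polytope_diamond_sector polytope_linear_image[OF M(1)] by blast
  moreover have "finite ((\<lambda>d. M ` diamond_sector d) ` axis_directions)" by simp
  ultimately show ?thesis
    unfolding tame_def using g eq by blast
qed

section \<open>Fundamental groups of increasing unions\<close>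

definition wind :: "('a \<Rightarrow> complex) \<Rightarrow> (real \<Rightarrow> 'a) \<Rightarrow> complex" where
  "wind \<theta> p = winding_number (\<theta> \<circ> p) 0"

lemma loops_continuous_image:
  assumes "p \<in> loops S x" "continuous_on S g" "g ` S \<subseteq> T"
  shows "g \<circ> p \<in> loops T (g x)"
proof -
  have p: "path p" "path_image p \<subseteq> S" "pathstart p = x" "pathfinish p = x"
    using assms(1) by (auto simp: loops_def)
  have "path (g \<circ> p)"
    using p(1) continuous_on_subset[OF assms(2) p(2)] by (rule path_continuous_image)
  moreover have "path_image (g \<circ> p) \<subseteq> T"
    unfolding path_image_compose using image_mono[OF p(2), of g] assms(3) by (rule subset_trans)
  ultimately show ?thesis using p by (simp add: loops_def pathstart_compose pathfinish_compose)
qed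

lemma homotopic_paths_compact_carrier:
  fixes S :: "'a::real_normed_vector set"
  assumes "homotopic_paths S p q"
  obtains K where "compact K" "K \<subseteq> S" "homotopic_paths K p q"
proof -
  obtain h where h: "continuous_on ({0..1} \<times> {0..1}) h" "h \<in> ({0..1::real} \<times> {0..1::real}) \<rightarrow> S"
    "\<forall>x \<in> {0..1}. h (0, x) = p x" "\<forall>x \<in> {0..1}. h (1, x) = q x"
    "\<forall>t \<in> {0..1::real}. pathstart (h \<circ> Pair t) = pathstart p \<and> pathfinish (h \<circ> Pair t) = pathfinish p"
    using assms unfolding homotopic_paths by blast
  let ?K = "h ` ({0..1} \<times> {0..1})"
  have "compact ?K" using h(1) by (intro compact_continuous_image compact_Times compact_Icc)
  moreover have "homotopic_paths ?K p q"
    unfolding homotopic_paths using h by (intro exI[of _ h]) auto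
  ultimately show ?thesis using that h(2) by blast
qed

lemma wind_homotopic:
  assumes "homotopic_paths U p q" "continuous_on U \<theta>" "\<And>x. x \<in> U \<Longrightarrow> \<theta> x \<noteq> 0"
  shows "wind \<theta> p = wind \<theta> q"
proof -
  have "homotopic_paths (- {0}) (\<theta> \<circ> p) (\<theta> \<circ> q)"
    using assms by (intro homotopic_paths_continuous_image[of U]) auto
  then show ?thesis unfolding wind_def by (rule winding_number_homotopic_paths)
qed

lemma wind_join:
  assumes "p \<in> loops U x" "q \<in> loops U x" "continuous_on U \<theta>" "\<And>y. y \<in> U \<Longrightarrow> \<theta> y \<noteq> 0"
  shows "wind \<theta> (p +++ q) = wind \<theta> p + wind \<theta> q"
proof -
  have "\<theta> \<circ> (p +++ q) = (\<theta> \<circ> p) +++ (\<theta> \<circ> q)" by (auto simp: joinpaths_def)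
  moreover have "path (\<theta> \<circ> r)" "0 \<notin> path_image (\<theta> \<circ> r)" if "r \<in> loops U x" for r
    using that assms(3,4) unfolding loops_def
    by (auto simp: path_image_compose intro!: path_continuous_image continuous_on_subset[of U])
  ultimately show ?thesis unfolding wind_def
    using assms(1,2) by (simp add: winding_number_join loops_def pathstart_compose pathfinish_compose)
qed

lemma wind_integer:
  assumes "p \<in> loops U x" "continuous_on U \<theta>" "\<And>y. y \<in> U \<Longrightarrow> \<theta> y \<noteq> 0"
  obtains k :: int where "wind \<theta> p = of_int k"
proof -
  have "path (\<theta> \<circ> p)" "0 \<notin> path_image (\<theta> \<circ> p)" "pathfinish (\<theta> \<circ> p) = pathstart (\<theta> \<circ> p)"
    using assms unfolding loops_def
    by (auto simp: path_image_compose pathstart_compose pathfinish_compose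
        intro!: path_continuous_image continuous_on_subset[of U])
  then have "winding_number (\<theta> \<circ> p) 0 \<in> \<int>" by (intro integer_winding_number) auto
  then show ?thesis using that unfolding wind_def Ints_def by blast
qed

definition stage_degree :: "(nat \<Rightarrow> nat) \<Rightarrow> nat \<Rightarrow> nat" where
  "stage_degree n i = (\<Prod>j=1..i. n j)"

lemma stage_degree_simps [simp]:
  "stage_degree n 0 = 1" "stage_degree n (Suc i) = stage_degree n i * n (Suc i)"
  by (simp_all add: stage_degree_def)

text \<open>The direct limit of copies of the integers under multiplication by \<open>n 1, n 2, \<dots>\<close>, realized
  inside the rationals.\<close>
definition fractions_group :: "(nat \<Rightarrow> nat) \<Rightarrow> rat set" where
  "fractions_group n = {q. \<exists>i. q * of_nat (stage_degree n i) \<in> \<int>}"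

lemma fractions_group_mono:
  fixes n :: "nat \<Rightarrow> nat"
  assumes "q * of_nat (stage_degree n i) \<in> (\<int> :: rat set)" "i \<le> k"
  shows "q * of_nat (stage_degree n k) \<in> (\<int> :: rat set)"
  using assms(2)
proof (induction k rule: dec_induct)
  case (step k)
  have "q * of_nat (stage_degree n (Suc k)) = (q * of_nat (stage_degree n k)) * of_nat (n (Suc k))"
    by (simp add: mult.assoc)
  then show ?case using step by (metis Ints_mult Ints_of_nat)
qed (rule assms)

lemma subgroup_fractions_group: "subgroup (fractions_group n) rat_group"
proof -
  interpret group rat_group by (rule group_rat_group)
  show ?thesis
  proof
    fix x y assume "x \<in> fractions_group n" "y \<in> fractions_group n"
    then obtain i k where ik: "x * of_nat (stage_degree n i) \<in> \<int>" "y * of_nat (stage_degree n k) \<in> \<int>"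
      by (auto simp: fractions_group_def)
    have "x * of_nat (stage_degree n (max i k)) + y * of_nat (stage_degree n (max i k)) \<in> \<int>"
      by (intro Ints_add fractions_group_mono[OF ik(1)] fractions_group_mono[OF ik(2)]) auto
    then have "(x + y) * of_nat (stage_degree n (max i k)) \<in> \<int>" by (simp only: distrib_right)
    then show "x \<otimes>\<^bsub>rat_group\<^esub> y \<in> fractions_group n"
      unfolding fractions_group_def by (auto simp: rat_group_def)
  next
    fix x assume x: "x \<in> fractions_group n"
    have "inv\<^bsub>rat_group\<^esub> x = - x"
      by (rule inv_equality) (auto simp: rat_group_def)
    then show "inv\<^bsub>rat_group\<^esub> x \<in> fractions_group n"
      using x by (auto simp: fractions_group_def)
  qed (auto simp: fractions_group_def rat_group_def)
qed

text \<open>An increasing union of stages, each of which has an infinite cyclic fundamental group that is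
  detected by winding numbers. Passing from stage \<open>i\<close> to stage \<open>i + 1\<close> multiplies them by
  \<open>n (i + 1)\<close>. Compact sets lie in a single stage, hence so do loops and homotopies of loops.\<close>
locale winding_tower =
  fixes U :: "nat \<Rightarrow> 'a::real_normed_vector set" and X :: "'a set"
    and \<theta> :: "nat \<Rightarrow> 'a \<Rightarrow> complex" and n :: "nat \<Rightarrow> nat"
  assumes n_pos: "\<And>i. n (Suc i) > 0"
    and exhaust: "\<And>K. compact K \<Longrightarrow> K \<subseteq> X \<Longrightarrow> \<exists>i. K \<subseteq> U i"
    and U_mono: "\<And>i. U i \<subseteq> U (Suc i)" and U_sub: "\<And>i. U i \<subseteq> X"
    and \<theta>_cont: "\<And>i. continuous_on (U i) (\<theta> i)" and \<theta>_nz: "\<And>i x. x \<in> U i \<Longrightarrow> \<theta> i x \<noteq> 0"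
    and faithful: "\<And>i x p q. p \<in> loops (U i) x \<Longrightarrow> q \<in> loops (U i) x \<Longrightarrow>
        wind (\<theta> i) p = wind (\<theta> i) q \<Longrightarrow> homotopic_paths (U i) p q"
    and full: "\<And>i x k. x \<in> U i \<Longrightarrow> \<exists>p \<in> loops (U i) x. wind (\<theta> i) p = of_int k"
    and transition: "\<And>i x p. p \<in> loops (U i) x \<Longrightarrow>
        wind (\<theta> (Suc i)) p = of_nat (n (Suc i)) * wind (\<theta> i) p"
begin

abbreviation N :: "nat \<Rightarrow> nat" where
  "N \<equiv> stage_degree n"

lemma N_pos: "N i > 0"
  by (induction i) (auto simp: n_pos)

lemma U_mono': "i \<le> k \<Longrightarrow> U i \<subseteq> U k"
  using U_mono by (rule lift_Suc_mono_le)

lemma loops_mono: "p \<in> loops (U i) x \<Longrightarrow> i \<le> k \<Longrightarrow> p \<in> loops (U k) x"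
  using U_mono'[of i k] by (auto simp: loops_def)

lemma transition':
  assumes "p \<in> loops (U i) x" "i \<le> k"
  shows "wind (\<theta> k) p * of_nat (N i) = wind (\<theta> i) p * of_nat (N k)"
  using assms(2)
proof (induction k rule: dec_induct)
  case (step k)
  have "wind (\<theta> (Suc k)) p = of_nat (n (Suc k)) * wind (\<theta> k) p"
    using loops_mono[OF assms(1) \<open>i \<le> k\<close>] by (rule transition)
  then have "wind (\<theta> (Suc k)) p * of_nat (N i) = of_nat (n (Suc k)) * (wind (\<theta> k) p * of_nat (N i))"
    by (simp add: mult_ac)
  also have "\<dots> = wind (\<theta> i) p * of_nat (N (Suc k))" unfolding step.IH by (simp add: mult_ac)
  finally show ?case .
qed simp

lemma loops_stage: "p \<in> loops X x \<Longrightarrow> \<exists>i. p \<in> loops (U i) x"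
  using exhaust[of "path_image p"] by (auto simp: loops_def compact_path_image)

text \<open>\<open>slope p\<close> is the rational number that a loop represents in the direct limit: its winding
  number at any stage divided by the degree of that stage over stage 0.\<close>

definition slope :: "(real \<Rightarrow> 'a) \<Rightarrow> rat" where
  "slope p = (THE q. \<exists>i k x. p \<in> loops (U i) x \<and> wind (\<theta> i) p = of_int k \<and> q = of_int k / of_nat (N i))"

lemma slope_eq:
  assumes "p \<in> loops (U i) x" "wind (\<theta> i) p = of_int k"
  shows "slope p = of_int k / of_nat (N i)"
  unfolding slope_def
proof (rule the_equality)
  show "\<exists>i' k' x. p \<in> loops (U i') x \<and> wind (\<theta> i') p = of_int k' \<and>
      (of_int k / of_nat (N i) :: rat) = of_int k' / of_nat (N i')"
    using assms by blast
  fix q :: rat assume "\<exists>i k x. p \<in> loops (U i) x \<and> wind (\<theta> i) p = of_int k \<and> q = of_int k / of_nat (N i)"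
  then obtain i' k' x' where q: "p \<in> loops (U i') x'" "wind (\<theta> i') p = of_int k'" "q = of_int k' / of_nat (N i')"
    by blast
  have same: "k * int (N j') = k' * int (N j)"
    if "p \<in> loops (U j) y" "wind (\<theta> j) p = of_int k" "wind (\<theta> j') p = of_int k'" "j \<le> j'"
    for j j' k k' y
  proof -
    have "(of_int (k' * int (N j)) :: complex) = of_int (k * int (N j'))"
      using transition'[OF that(1,4)] that(2,3) by simp
    then show ?thesis unfolding of_int_eq_iff by simp
  qed
  have "k * int (N i') = k' * int (N i)"
    using same[OF assms q(2)] same[OF q(1,2) assms(2)] by (cases "i \<le> i'") auto
  then have "(of_int k * of_nat (N i') :: rat) = of_int k' * of_nat (N i)"
    by (metis of_int_mult of_int_of_nat_eq)
  moreover have "(of_nat (N i) :: rat) \<noteq> 0" "(of_nat (N i') :: rat) \<noteq> 0"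
    using N_pos[of i] N_pos[of i'] by (simp_all only: of_nat_eq_0_iff neq0_conv)
  ultimately show "q = of_int k / of_nat (N i)" by (simp add: q(3) frac_eq_eq)
qed

lemma common_stage:
  assumes "p \<in> loops X x" "q \<in> loops X x"
  obtains i k l where "p \<in> loops (U i) x" "q \<in> loops (U i) x"
    "wind (\<theta> i) p = of_int k" "wind (\<theta> i) q = of_int l"
proof -
  obtain i j where "p \<in> loops (U i) x" "q \<in> loops (U j) x" using assms loops_stage by metis
  then have m: "p \<in> loops (U (max i j)) x" "q \<in> loops (U (max i j)) x"
    using loops_mono by (meson max.cobounded1 max.cobounded2)+
  obtain k l where "wind (\<theta> (max i j)) p = of_int k" "wind (\<theta> (max i j)) q = of_int l"
    using wind_integer[OF m(1) \<theta>_cont \<theta>_nz] wind_integer[OF m(2) \<theta>_cont \<theta>_nz] by metis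
  then show ?thesis using that m by blast
qed

text \<open>A homotopy in the union takes place in one stage, where it preserves winding numbers. Conversely,
  two loops with equal slopes have equal winding numbers at a common stage.\<close>
lemma slope_homotopic_iff:
  assumes pq: "p \<in> loops X x" "q \<in> loops X x"
  shows "homotopic_paths X p q \<longleftrightarrow> slope p = slope q"
proof
  assume "slope p = slope q"
  obtain i k l where i: "p \<in> loops (U i) x" "q \<in> loops (U i) x"
    "wind (\<theta> i) p = of_int k" "wind (\<theta> i) q = of_int l"
    using common_stage[OF pq] by metis
  have "(of_nat (N i) :: rat) \<noteq> 0" using N_pos[of i] by (simp only: of_nat_eq_0_iff neq0_conv)
  then have "k = l"
    using \<open>slope p = slope q\<close> slope_eq[OF i(1,3)] slope_eq[OF i(2,4)] by simp
  then have "homotopic_paths (U i) p q" using faithful i by metis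
  then show "homotopic_paths X p q" using U_sub homotopic_paths_subset by metis
next
  assume "homotopic_paths X p q"
  then obtain K where K: "compact K" "K \<subseteq> X" "homotopic_paths K p q"
    by (rule homotopic_paths_compact_carrier)
  then obtain i where i: "K \<subseteq> U i" using exhaust by blast
  then have h: "homotopic_paths (U i) p q" using K(3) homotopic_paths_subset by metis
  then have l: "p \<in> loops (U i) x" "q \<in> loops (U i) x"
    using pq homotopic_paths_imp_subset[OF h] by (auto simp: loops_def)
  obtain k where k: "wind (\<theta> i) p = of_int k" using wind_integer[OF l(1) \<theta>_cont \<theta>_nz] by metis
  moreover have "wind (\<theta> i) p = wind (\<theta> i) q" by (rule wind_homotopic[OF h \<theta>_cont \<theta>_nz])
  ultimately show "slope p = slope q" using slope_eq l by metis
qed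

lemma slope_join:
  assumes pq: "p \<in> loops X x" "q \<in> loops X x"
  shows "slope (p +++ q) = slope p + slope q"
proof -
  obtain i k l where i: "p \<in> loops (U i) x" "q \<in> loops (U i) x"
    "wind (\<theta> i) p = of_int k" "wind (\<theta> i) q = of_int l"
    using common_stage[OF pq] by metis
  have "p +++ q \<in> loops (U i) x" using i by (auto simp: loops_def path_image_join)
  moreover have "wind (\<theta> i) (p +++ q) = of_int (k + l)"
    using wind_join[OF i(1,2) \<theta>_cont \<theta>_nz] i by simp
  ultimately have "slope (p +++ q) = of_int (k + l) / of_nat (N i)" by (rule slope_eq)
  then show ?thesis using slope_eq[OF i(1,3)] slope_eq[OF i(2,4)]
    by (simp add: add_divide_distrib)
qed

lemma slope_image:
  assumes "x \<in> X"
  shows "slope ` loops X x = fractions_group n"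
proof
  show "slope ` loops X x \<subseteq> fractions_group n"
  proof (rule image_subsetI)
    fix p assume p: "p \<in> loops X x"
    obtain i k l where i: "p \<in> loops (U i) x" "wind (\<theta> i) p = of_int k"
      using common_stage[OF p p] by metis
    have "(of_nat (N i) :: rat) \<noteq> 0" using N_pos[of i] by (simp only: of_nat_eq_0_iff neq0_conv)
    then have "slope p * of_nat (N i) = of_int k" using slope_eq[OF i] by simp
    then have "slope p * of_nat (N i) \<in> \<int>" by (simp only: Ints_of_int)
    then show "slope p \<in> fractions_group n" unfolding fractions_group_def by blast
  qed
  show "fractions_group n \<subseteq> slope ` loops X x"
  proof
    fix q assume "q \<in> fractions_group n"
    then obtain i where i: "q * of_nat (N i) \<in> \<int>" by (auto simp: fractions_group_def)
    obtain j where j: "x \<in> U j" using exhaust[of "{x}"] assms by auto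
    let ?m = "max i j"
    have "q * of_nat (N ?m) \<in> \<int>" by (rule fractions_group_mono[OF i]) simp
    then obtain k where k: "q * of_nat (N ?m) = of_int k" by (auto simp: Ints_def)
    have "x \<in> U ?m" using j U_mono'[of j ?m] by auto
    then obtain p where p: "p \<in> loops (U ?m) x" "wind (\<theta> ?m) p = of_int k" using full by metis
    have "(of_nat (N ?m) :: rat) \<noteq> 0" using N_pos[of ?m] by (simp only: of_nat_eq_0_iff neq0_conv)
    then have "slope p = q" using slope_eq[OF p] k[symmetric] by simp
    moreover have "p \<in> loops X x" using p(1) U_sub[of ?m] by (auto simp: loops_def)
    ultimately show "q \<in> slope ` loops X x" by blast
  qed
qed

text \<open>The isomorphism is induced by \<open>slope\<close>.\<close>
theorem fundamental_group_tower:
  assumes x: "x \<in> X"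
  shows "fundamental_group X x \<cong> rat_group\<lparr>carrier := fractions_group n\<rparr>"
proof -
  let ?G = "fundamental_group X x"
  define c where "c p = {r. homotopic_paths X p r}" for p
  have carr: "carrier ?G = c ` loops X x"
    by (auto simp: fundamental_group_def quotient_def c_def)
  have loop: "r \<in> loops X x" if "p \<in> loops X x" "r \<in> c p" for p r
    using that homotopic_paths_imp_path[of X p r] homotopic_paths_imp_subset[of X p r]
      homotopic_paths_imp_pathstart[of X p r] homotopic_paths_imp_pathfinish[of X p r]
    by (auto simp: c_def loops_def)
  have self: "p \<in> c p" if "p \<in> loops X x" for p
    using that by (auto simp: c_def loops_def)
  define h where "h A = slope (SOME p. p \<in> A)" for A
  have h: "h (c p) = slope p" if p: "p \<in> loops X x" for p
  proof -
    have "(SOME r. r \<in> c p) \<in> c p" using someI[of "\<lambda>r. r \<in> c p" p] self[OF p] by simp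
    then show ?thesis
      unfolding h_def using slope_homotopic_iff[OF p loop[OF p]] by (metis c_def mem_Collect_eq)
  qed
  have join: "p +++ q \<in> loops X x" if "p \<in> loops X x" "q \<in> loops X x" for p q
    using that by (auto simp: loops_def path_image_join)
  have mult: "c p \<otimes>\<^bsub>?G\<^esub> c q = c (p +++ q)" if pq: "p \<in> loops X x" "q \<in> loops X x" for p q
  proof -
    have "c (p' +++ q') = c (p +++ q)" if "p' \<in> c p" "q' \<in> c q" for p' q'
    proof -
      have "homotopic_paths X (p +++ q) (p' +++ q')"
        using that pq by (intro homotopic_paths_join) (auto simp: c_def loops_def)
      then show ?thesis
        unfolding c_def by (blast intro: homotopic_paths_trans homotopic_paths_sym)
    qed
    moreover have "c p \<otimes>\<^bsub>?G\<^esub> c q = (\<Union>p'\<in>c p. \<Union>q'\<in>c q. c (p' +++ q'))"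
      by (simp add: fundamental_group_def c_def)
    ultimately show ?thesis using self[OF pq(1)] self[OF pq(2)] by blast
  qed
  have "h \<in> hom ?G (rat_group\<lparr>carrier := fractions_group n\<rparr>)"
  proof (rule homI)
    fix A assume "A \<in> carrier ?G"
    then show "h A \<in> carrier (rat_group\<lparr>carrier := fractions_group n\<rparr>)"
      using slope_image[OF x] by (auto simp: carr h)
  next
    fix A B assume "A \<in> carrier ?G" "B \<in> carrier ?G"
    then show "h (A \<otimes>\<^bsub>?G\<^esub> B) = h A \<otimes>\<^bsub>rat_group\<lparr>carrier := fractions_group n\<rparr>\<^esub> h B"
      by (auto simp: carr mult h join slope_join rat_group_def)
  qed
  moreover have "inj_on h (carrier ?G)"
  proof (rule inj_onI)
    fix A B assume "A \<in> carrier ?G" "B \<in> carrier ?G" "h A = h B"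
    then obtain p q where pq: "p \<in> loops X x" "q \<in> loops X x" "A = c p" "B = c q" "slope p = slope q"
      by (auto simp: carr h)
    then have "homotopic_paths X p q" using slope_homotopic_iff by metis
    then show "A = B" unfolding pq c_def by (blast intro: homotopic_paths_trans homotopic_paths_sym)
  qed
  moreover have "h ` carrier ?G = fractions_group n"
  proof -
    have "h ` carrier ?G = (\<lambda>p. h (c p)) ` loops X x" by (simp only: carr image_image)
    also have "\<dots> = slope ` loops X x" by (intro image_cong) (simp_all add: h)
    finally show ?thesis using slope_image[OF x] by simp
  qed
  ultimately have "h \<in> iso ?G (rat_group\<lparr>carrier := fractions_group n\<rparr>)"
    by (auto simp: iso_def bij_betw_def)
  then show ?thesis by (auto simp: is_iso_def)
qed

end

section \<open>Loops in the complement of the standard solid torus\<close>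

definition torus_complement :: "(complex \<times> complex) set" where
  "torus_complement = {p \<in> S3C. 4/5 < cmod (snd p)}"

lemma mem_torus_complement:
  "p \<in> torus_complement \<longleftrightarrow>
     (cmod (fst p))\<^sup>2 + (cmod (snd p))\<^sup>2 = 1 \<and> 4/5 < cmod (snd p)"
  by (cases p) (simp only: torus_complement_def mem_Collect_eq mem_S3C fst_conv snd_conv)

text \<open>The universal cover \<open>ball \<times> \<complex> \<rightarrow> torus_complement\<close>, up to the contractible real
  direction of its second factor. Straight lines upstairs give all homotopies needed.\<close>

definition cover :: "complex \<Rightarrow> complex \<Rightarrow> complex \<times> complex" where
  "cover z c = (z, of_real (sqrt (1 - (cmod z)\<^sup>2)) * exp (\<i> * of_real (Im c)))"

lemma cover_in:
  assumes "cmod z < 3/5"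
  shows "cover z c \<in> torus_complement"
proof -
  have "(cmod z)\<^sup>2 < (3/5)\<^sup>2" using assms by (intro power_strict_mono) auto
  then have z: "(4/5)\<^sup>2 < 1 - (cmod z)\<^sup>2" unfolding power_divide by simp
  then have "4/5 < sqrt (1 - (cmod z)\<^sup>2)" by (intro real_less_rsqrt) 
  moreover have "0 \<le> 1 - (cmod z)\<^sup>2" using z by (smt (verit) zero_le_power2)
  ultimately show ?thesis
    by (simp add: cover_def mem_torus_complement norm_mult)
qed

lemma torus_complement_fst:
  assumes "p \<in> torus_complement"
  shows "cmod (fst p) < 3/5" "snd p \<noteq> 0"
proof -
  have eq: "(cmod (fst p))\<^sup>2 + (cmod (snd p))\<^sup>2 = 1" and gt: "4/5 < cmod (snd p)"
    using assms by (auto simp: mem_torus_complement)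
  have "(4/5)\<^sup>2 < (cmod (snd p))\<^sup>2" using gt by (intro power_strict_mono) auto
  then have "(cmod (fst p))\<^sup>2 < (3/5)\<^sup>2" using eq unfolding power_divide by simp
  then show "cmod (fst p) < 3/5" by (rule power2_less_imp_less) simp
  show "snd p \<noteq> 0" using gt by auto
qed

lemma cover_log:
  assumes "p \<in> torus_complement" "snd p = exp c"
  shows "cover (fst p) c = p"
proof -
  have "(cmod (fst p))\<^sup>2 + (cmod (snd p))\<^sup>2 = 1"
    using assms(1) by (simp add: mem_torus_complement)
  then have "sqrt (1 - (cmod (fst p))\<^sup>2) = cmod (snd p)" by (intro real_sqrt_unique) auto
  then have r: "sqrt (1 - (cmod (fst p))\<^sup>2) = exp (Re c)" by (simp add: assms(2))
  have "exp c = of_real (exp (Re c)) * exp (\<i> * of_real (Im c))"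
    using exp_eq_polar[of c] by (simp add: cis_conv_exp)
  then show ?thesis unfolding cover_def r by (metis assms(2) prod.collapse)
qed

lemma continuous_cover:
  assumes "continuous_on X f" "continuous_on X g"
  shows "continuous_on X (\<lambda>x. cover (f x) (g x))"
  unfolding cover_def by (intro continuous_intros assms)

lemma ball_convex_combination:
  assumes "cmod y < 3/5" "cmod z < 3/5" "0 \<le> s" "s \<le> (1::real)"
  shows "cmod (of_real (1 - s) * y + of_real s * z) < 3/5"
proof -
  have "(1 - s) *\<^sub>R y + s *\<^sub>R z \<in> ball 0 (3/5)"
    using assms by (intro convexD[OF convex_ball]) auto
  then show ?thesis by (simp add: scaleR_conv_of_real del: of_real_diff)
qed

text \<open>A loop has a lift to the cover: its first coordinate and a continuous logarithm of its second
  coordinate.\<close>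
lemma loop_log:
  assumes "p \<in> loops torus_complement x"
  shows "\<exists>a. path a \<and> a 1 - a 0 = 2 * of_real pi * \<i> * wind snd p \<and>
    (\<forall>t\<in>{0..1}. snd (p t) = exp (a t)) \<and> (\<forall>t\<in>{0..1}. p t \<in> torus_complement) \<and>
    continuous_on {0..1} p \<and> p 0 = x \<and> p 1 = x"
proof -
  have p: "path p" "path_image p \<subseteq> torus_complement" "p 0 = x" "p 1 = x"
    using assms by (auto simp: loops_def pathstart_def pathfinish_def)
  have "path (snd \<circ> p)" using p(1) by (intro path_continuous_image continuous_intros)
  moreover have "0 \<notin> path_image (snd \<circ> p)"
    using p(2) torus_complement_fst(2) by (force simp: path_image_compose)
  ultimately obtain a where a: "path a" "pathfinish a - pathstart a = 2 * of_real pi * \<i> * winding_number (snd \<circ> p) 0"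
    "\<And>t. t \<in> {0..1} \<Longrightarrow> (snd \<circ> p) t = 0 + exp (a t)"
    using winding_number_as_continuous_log[of "snd \<circ> p" 0] by metis
  have "p t \<in> torus_complement" if "t \<in> {0..1}" for t
    using p(2) that by (auto simp: path_image_def)
  then show ?thesis using a p
    by (intro exI[of _ a]) (simp add: wind_def pathstart_def pathfinish_def path_def)
qed

text \<open>Lifts of two loops with the same winding number can be chosen with the same end points; the
  straight line homotopy between them projects to a homotopy of the loops.\<close>
lemma torus_complement_faithful:
  assumes p: "p \<in> loops torus_complement x" and q: "q \<in> loops torus_complement x"
    and w: "wind snd p = wind snd q"
  shows "homotopic_paths torus_complement p q"
proof -
  obtain a where a0: "path a \<and> a 1 - a 0 = 2 * of_real pi * \<i> * wind snd p \<and>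
    (\<forall>t\<in>{0..1}. snd (p t) = exp (a t)) \<and> (\<forall>t\<in>{0..1}. p t \<in> torus_complement) \<and>
    continuous_on {0..1} p \<and> p 0 = x \<and> p 1 = x"
    using loop_log[OF p] by blast
  have a: "path a" "a 1 - a 0 = 2 * of_real pi * \<i> * wind snd p"
    "\<And>t. t \<in> {0..1} \<Longrightarrow> snd (p t) = exp (a t)" "\<And>t. t \<in> {0..1} \<Longrightarrow> p t \<in> torus_complement"
    "continuous_on {0..1} p" "p 0 = x" "p 1 = x"
    using a0 by auto
  obtain b where b0: "path b \<and> b 1 - b 0 = 2 * of_real pi * \<i> * wind snd q \<and>
    (\<forall>t\<in>{0..1}. snd (q t) = exp (b t)) \<and> (\<forall>t\<in>{0..1}. q t \<in> torus_complement) \<and>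
    continuous_on {0..1} q \<and> q 0 = x \<and> q 1 = x"
    using loop_log[OF q] by blast
  have b: "path b" "b 1 - b 0 = 2 * of_real pi * \<i> * wind snd q"
    "\<And>t. t \<in> {0..1} \<Longrightarrow> snd (q t) = exp (b t)" "\<And>t. t \<in> {0..1} \<Longrightarrow> q t \<in> torus_complement"
    "continuous_on {0..1} q" "q 0 = x" "q 1 = x"
    using b0 by auto
  \<comment> \<open>Another lift of \<open>q\<close>, as \<open>a 0 - b 0\<close> is a multiple of \<open>2 \<pi> \<i>\<close>.\<close>
  define b' where "b' t = b t + (a 0 - b 0)" for t
  have b'0: "b' 0 = a 0" "b' 1 = a 1" using a(2) b(2) w by (auto simp: b'_def algebra_simps)
  have "exp (a 0) = exp (b 0)" using a(3)[of 0] b(3)[of 0] a(6) b(6) by simp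
  then have "exp (a 0 - b 0) = 1" by (simp add: exp_diff)
  then have b'e: "snd (q t) = exp (b' t)" if "t \<in> {0..1}" for t
    using b(3)[OF that] by (simp add: b'_def exp_add)
  have ca: "continuous_on {0..1} a" and cb: "continuous_on {0..1} b'"
    using a(1) b(1) unfolding b'_def path_def by (auto intro!: continuous_intros)
  define h where "h = (\<lambda>(s, t). cover (of_real (1 - s) * fst (p t) + of_real s * fst (q t))
    (of_real (1 - s) * a t + of_real s * b' t))"
  have c: "continuous_on ({0..1} \<times> {0..1}) (\<lambda>y :: real \<times> real. f (snd y))"
    if "continuous_on {0..1} f" for f :: "real \<Rightarrow> complex"
    using that by (rule continuous_on_compose2) (auto intro: continuous_intros)
  show ?thesis
    unfolding homotopic_paths
  proof (intro exI[of _ h] conjI ballI)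
    show "continuous_on ({0..1} \<times> {0..1}) h"
      unfolding h_def case_prod_beta
      by (intro continuous_cover continuous_on_add continuous_on_mult c ca cb)
        (auto intro!: continuous_intros a(5) b(5))
    show "h \<in> ({0..1} \<times> {0..1}) \<rightarrow> torus_complement"
      unfolding h_def
      using torus_complement_fst(1)[OF a(4)] torus_complement_fst(1)[OF b(4)]
      by (auto intro!: cover_in ball_convex_combination simp del: of_real_diff)
    show "h (0, t) = p t" "h (1, t) = q t" if "t \<in> {0..1}" for t
      using cover_log[OF a(4)[OF that] a(3)[OF that]] cover_log[OF b(4)[OF that] b'e[OF that]]
      by (simp_all add: h_def)
    fix s :: real
    have e: "of_real (1 - s) * y + of_real s * y = y" for y :: complex by (simp add: algebra_simps)
    have "cover (fst x) (a 0) = x" "cover (fst x) (a 1) = x"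
      using cover_log[OF a(4) a(3), of 0] cover_log[OF a(4) a(3), of 1] a(6,7) by auto
    then show "pathstart (h \<circ> Pair s) = pathstart p" "pathfinish (h \<circ> Pair s) = pathfinish p"
      using a(6,7) b(6,7) by (simp_all only: pathstart_def pathfinish_def h_def o_def case_prod_conv b'0 e)
  qed
qed

lemma torus_complement_full:
  assumes x: "x \<in> torus_complement"
  shows "\<exists>p \<in> loops torus_complement x. wind snd p = of_int k"
proof -
  define a where "a t = Ln (snd x) + of_real t * (2 * of_real pi * \<i> * of_int k)" for t :: real
  define p where "p t = (fst x, exp (a t))" for t
  have pa: "path a" unfolding a_def path_def by (intro continuous_intros)
  have nz: "snd x \<noteq> 0" using torus_complement_fst(2)[OF x] .
  have n: "cmod (exp (a t)) = cmod (snd x)" for t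
    using nz by (simp add: a_def exp_add norm_mult)
  have "p t \<in> torus_complement" for t
    using x n[of t] by (simp only: mem_torus_complement p_def fst_conv snd_conv)
  moreover have "p 0 = x" using nz by (simp add: p_def a_def)
  moreover have "p 1 = x"
  proof -
    have "exp (2 * of_real pi * \<i> * of_int k) = (1 :: complex)"
      by (auto simp: exp_eq_1)
    then show ?thesis using nz by (simp add: p_def a_def exp_add)
  qed
  moreover have "path p" unfolding p_def a_def path_def by (intro continuous_intros)
  ultimately have "p \<in> loops torus_complement x"
    by (auto simp: loops_def path_image_def pathstart_def pathfinish_def)
  moreover have "wind snd p = of_int k"
  proof -
    have "snd \<circ> p = exp \<circ> a" by (auto simp: p_def)
    then show ?thesis unfolding wind_def using winding_number_compose_exp[OF pa]
      by (simp add: pathstart_def pathfinish_def a_def)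
  qed
  ultimately show ?thesis by blast
qed

text \<open>Every loop can be contracted radially into the core circle \<open>z = 0\<close>, where \<open>\<beta>\<close> is an \<open>n\<close>-th power.\<close>

lemma torus_complement_degree:
  assumes p: "p \<in> loops torus_complement x"
    and \<beta>: "continuous_on torus_complement \<beta>" "\<And>y. y \<in> torus_complement \<Longrightarrow> \<beta> y \<noteq> 0"
    and core: "\<And>\<eta>. \<eta> \<in> circ \<Longrightarrow> \<beta> (0, \<eta>) = k * \<eta> ^ n"
  shows "wind \<beta> p = of_nat n * wind snd p"
proof -
  obtain a where a0: "path a \<and> a 1 - a 0 = 2 * of_real pi * \<i> * wind snd p \<and>
    (\<forall>t\<in>{0..1}. snd (p t) = exp (a t)) \<and> (\<forall>t\<in>{0..1}. p t \<in> torus_complement) \<and>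
    continuous_on {0..1} p \<and> p 0 = x \<and> p 1 = x"
    using loop_log[OF p] by blast
  have a: "path a" "a 1 - a 0 = 2 * of_real pi * \<i> * wind snd p"
    "\<And>t. t \<in> {0..1} \<Longrightarrow> snd (p t) = exp (a t)" "\<And>t. t \<in> {0..1} \<Longrightarrow> p t \<in> torus_complement"
    "continuous_on {0..1} p" "p 0 = x" "p 1 = x"
    using a0 by auto
  have ca: "continuous_on {0..1} a" using a(1) by (simp add: path_def)
  have "continuous_on torus_complement snd" by (intro continuous_intros)
  from wind_integer[OF p this torus_complement_fst(2)]
  obtain m :: int where m: "wind snd p = of_int m" by blast
  define p0 where "p0 t = cover 0 (a t)" for t
  define h where "h = (\<lambda>(s, t). cover (of_real (1 - s) * fst (p t)) (a t))"
  have c: "continuous_on ({0..1} \<times> {0..1}) (\<lambda>y :: real \<times> real. f (snd y))"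
    if "continuous_on {0..1} f" for f :: "real \<Rightarrow> complex"
    using that by (rule continuous_on_compose2) (auto intro: continuous_intros)
  have im: "Im (a 1) = Im (a 0) + 2 * pi * of_int m"
    using arg_cong[OF a(2), of Im] by (simp add: m)
  have per: "cover z (a 1) = cover z (a 0)" for z
  proof -
    have "exp (\<i> * of_real (2 * pi * of_int m)) = (1 :: complex)"
      by (auto simp: exp_eq_1)
    then show ?thesis unfolding cover_def im of_real_add ring_distribs exp_add by simp
  qed
  have "homotopic_loops torus_complement p p0"
    unfolding homotopic_loops
  proof (intro exI[of _ h] conjI ballI)
    show "continuous_on ({0..1} \<times> {0..1}) h"
      unfolding h_def case_prod_beta
      by (intro continuous_cover continuous_on_mult c ca)
        (auto intro!: continuous_intros a(5))
    show "h \<in> ({0..1} \<times> {0..1}) \<rightarrow> torus_complement"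
    proof clarsimp
      fix s t :: real assume st: "0 \<le> s" "s \<le> 1" "0 \<le> t" "t \<le> 1"
      have "cmod (of_real (1 - s) * fst (p t) + of_real s * 0) < 3/5"
        using st torus_complement_fst(1)[OF a(4)] by (intro ball_convex_combination) auto
      then show "h (s, t) \<in> torus_complement" unfolding h_def by (simp add: cover_in)
    qed
    show "h (0, t) = p t" "h (1, t) = p0 t" if "t \<in> {0..1}" for t
      using cover_log[OF a(4)[OF that] a(3)[OF that]] by (simp_all add: h_def p0_def)
    show "pathfinish (h \<circ> Pair s) = pathstart (h \<circ> Pair s)" for s
      using a(6,7) by (simp add: pathstart_def pathfinish_def h_def per)
  qed
  then have "homotopic_loops (- {0}) (\<beta> \<circ> p) (\<beta> \<circ> p0)"
    using \<beta> by (intro homotopic_loops_continuous_image[of torus_complement]) auto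
  then have "wind \<beta> p = winding_number (\<beta> \<circ> p0) 0"
    unfolding wind_def by (rule winding_number_homotopic_loops)
  also have "\<beta> \<circ> p0 = exp \<circ> (\<lambda>t. Ln k + of_nat n * (\<i> * of_real (Im (a t))))"
  proof
    fix t
    have "cover 0 0 \<in> torus_complement" by (rule cover_in) simp
    then have "k \<noteq> 0" using \<beta>(2)[of "cover 0 0"] core[of 1] by (auto simp: cover_def)
    moreover have "\<beta> (p0 t) = k * exp (\<i> * of_real (Im (a t))) ^ n"
      unfolding p0_def cover_def using core[of "exp (\<i> * of_real (Im (a t)))"] by simp
    ultimately show "(\<beta> \<circ> p0) t = (exp \<circ> (\<lambda>t. Ln k + of_nat n * (\<i> * of_real (Im (a t))))) t"
      by (simp add: exp_add exp_of_nat_mult)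
  qed
  also have "winding_number \<dots> 0 = of_nat n * wind snd p"
  proof -
    have "path (\<lambda>t. Ln k + of_nat n * (\<i> * of_real (Im (a t))))"
      using ca unfolding path_def by (intro continuous_intros)
    then show ?thesis
      by (simp add: winding_number_compose_exp pathstart_def pathfinish_def im m field_simps)
  qed
  finally show ?thesis .
qed

section \<open>The intersection of braided solid tori\<close>

text \<open>A point of the intersection is sent to the sequence of the parameters of the meridian discs
  containing it. This map is injective because the discs become arbitrarily small, and surjective
  because for a thread of the solenoid the corresponding discs are nested and compact.\<close>
lemma solenoid_intersection:
  fixes h :: "nat \<Rightarrow> complex \<times> complex \<Rightarrow> 'a::{t2_space, heine_borel, metric_space}"
  assumes cont: "\<And>i. continuous_on solid_torus (h i)" and inj: "\<And>i. inj_on (h i) solid_torus"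
    and f_in: "\<And>i p. p \<in> solid_torus \<Longrightarrow> f i p \<in> solid_torus"
    and nest: "\<And>i p. p \<in> solid_torus \<Longrightarrow> h (Suc i) p = h i (f i p)"
    and fst_f: "\<And>i p. p \<in> solid_torus \<Longrightarrow> fst (f i p) = fst p ^ n (Suc i)"
    and thin: "\<And>e. e > 0 \<Longrightarrow> \<exists>i. \<forall>\<zeta> v v'. (\<zeta>, v) \<in> solid_torus \<longrightarrow> (\<zeta>, v') \<in> solid_torus \<longrightarrow>
      dist (h i (\<zeta>, v)) (h i (\<zeta>, v')) < e"
  shows "top_of_set (\<Inter>i. h i ` solid_torus) homeomorphic_space solenoid_space n"
proof -
  define X where "X = (\<Inter>i. h i ` solid_torus)"
  have cT: "compact solid_torus" by (intro compact_Times compact_sphere compact_cball)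
  have "\<exists>g. homeomorphism solid_torus (h i ` solid_torus) (h i) g" for i
    by (rule homeomorphism_compact[OF cT cont refl inj])
  then obtain g where g: "\<And>i. homeomorphism solid_torus (h i ` solid_torus) (h i) (g i)" by metis
  have g_in: "g i x \<in> solid_torus" and h_g: "h i (g i x) = x" if "x \<in> X" for i x
  proof -
    have x: "x \<in> h i ` solid_torus" using that unfolding X_def by blast
    show "g i x \<in> solid_torus" using imageI[OF x, of "g i"] homeomorphism_image2[OF g] by metis
    show "h i (g i x) = x" by (rule homeomorphism_apply2[OF g x])
  qed
  have g_h: "g i (h i p) = p" if "p \<in> solid_torus" for i p
    by (rule homeomorphism_apply1[OF g that])
  have g_Suc: "g i x = f i (g (Suc i) x)" if "x \<in> X" for i x
  proof -
    have "h i (f i (g (Suc i) x)) = h i (g i x)"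
      using nest[OF g_in[OF that], of i "Suc i"] h_g[OF that] by simp
    then show ?thesis using g_h[OF f_in[OF g_in[OF that]]] g_h[OF g_in[OF that]] by metis
  qed
  define s where "s x = (\<lambda>i. fst (g i x))" for x
  have top: "topspace (solenoid_space n) = {y. (\<forall>i. y i \<in> sphere 0 1) \<and> (\<forall>i. y i = y (Suc i) ^ n (Suc i))}"
  proof -
    have "topspace (product_topology (\<lambda>i :: nat. top_of_set (sphere (0 :: complex) 1)) UNIV)
        = {y. \<forall>i. y i \<in> sphere 0 1}"
      by (auto simp: PiE_UNIV_domain)
    then show ?thesis unfolding solenoid_space_def topspace_subtopology by blast
  qed
  have s_in: "s x \<in> topspace (solenoid_space n)" if "x \<in> X" for x
  proof -
    have "s x i \<in> sphere 0 1" for i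
      using g_in[OF that, of i] unfolding s_def mem_Times_iff by blast
    moreover have "s x i = s x (Suc i) ^ n (Suc i)" for i
      unfolding s_def using arg_cong[OF g_Suc[OF that, of i], of fst] fst_f[OF g_in[OF that]]
      by (rule trans)
    ultimately show ?thesis unfolding top by blast
  qed
  have "continuous_map (top_of_set X) (solenoid_space n) s"
    unfolding solenoid_space_def continuous_map_in_subtopology
  proof
    show "continuous_map (top_of_set X) (product_topology (\<lambda>i. top_of_set (sphere 0 1)) UNIV) s"
      unfolding continuous_map_componentwise_UNIV
    proof
      fix i
      have "continuous_on X (g i)"
        using g[of i] by (auto simp: homeomorphism_def X_def intro: continuous_on_subset)
      then have "continuous_on X (\<lambda>x. s x i)" unfolding s_def by (rule continuous_on_fst)
      moreover have "s x i \<in> sphere 0 1" if "x \<in> X" for x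
        using s_in[OF that] unfolding top by blast
      ultimately show "continuous_map (top_of_set X) (top_of_set (sphere 0 1)) (\<lambda>x. s x i)" by auto
    qed
    show "s \<in> topspace (top_of_set X) \<rightarrow> {x. \<forall>i. x i = x (Suc i) ^ n (Suc i)}"
      using s_in unfolding top topspace_euclidean_subtopology by blast
  qed
  moreover have "compact X"
  proof -
    have "compact (h i ` solid_torus)" for i using cont cT by (rule compact_continuous_image)
    then show ?thesis unfolding X_def by (intro compact_Inter) auto
  qed
  moreover have "Hausdorff_space (solenoid_space n)"
    unfolding solenoid_space_def
    by (intro Hausdorff_space_subtopology) (simp add: Hausdorff_space_product_topology Hausdorff_space_subtopology)
  moreover have "inj_on s X"
  proof (rule inj_onI)
    fix x y assume xy: "x \<in> X" "y \<in> X" "s x = s y"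
    have "dist x y < e" if e: "e > 0" for e
    proof -
      obtain i where i: "\<forall>\<zeta> v v'. (\<zeta>, v) \<in> solid_torus \<longrightarrow> (\<zeta>, v') \<in> solid_torus \<longrightarrow>
          dist (h i (\<zeta>, v)) (h i (\<zeta>, v')) < e" using thin[OF e] by blast
      have "fst (g i x) = fst (g i y)" using xy(3) unfolding s_def by metis
      then have "dist (h i (g i x)) (h i (g i y)) < e"
        using i g_in[OF xy(1), of i] g_in[OF xy(2), of i] by (metis prod.collapse)
      then show ?thesis using h_g xy by simp
    qed
    then show "x = y" by (metis dist_pos_lt less_irrefl)
  qed
  moreover have "s ` X = topspace (solenoid_space n)"
  proof
    show "s ` X \<subseteq> topspace (solenoid_space n)" using s_in by blast
    show "topspace (solenoid_space n) \<subseteq> s ` X"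
    proof
      fix y assume y: "y \<in> topspace (solenoid_space n)"
      define C where "C i = h i ` ({y i} \<times> cball 0 1)" for i
      have yi: "y i \<in> sphere 0 1" "y i = y (Suc i) ^ n (Suc i)" for i
        using y unfolding top by blast+
      have sub: "{y i} \<times> cball 0 1 \<subseteq> solid_torus" for i using yi(1)[of i] by auto
      have "compact (C i)" for i
        unfolding C_def using continuous_on_subset[OF cont sub]
        by (intro compact_continuous_image compact_Times) auto
      moreover have "C i \<noteq> {}" for i by (simp add: C_def)
      moreover have "C (Suc i) \<subseteq> C i" for i
      proof
        fix x assume "x \<in> C (Suc i)"
        then obtain v where v: "v \<in> cball 0 1" "x = h (Suc i) (y (Suc i), v)" by (auto simp: C_def)
        have t: "(y (Suc i), v) \<in> solid_torus" using yi(1)[of "Suc i"] v(1) by simp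
        have "x = h i (f i (y (Suc i), v))" using nest[OF t] v(2) by simp
        moreover have "fst (f i (y (Suc i), v)) = y i" using fst_f[OF t] yi(2)[of i] by simp
        moreover have "snd (f i (y (Suc i), v)) \<in> cball 0 1" using f_in[OF t, of i] by (simp only: mem_Times_iff)
        ultimately show "x \<in> C i" unfolding C_def
          by (intro image_eqI[of _ _ "f i (y (Suc i), v)"]) (auto simp: mem_Times_iff)
      qed
      then have "C k \<subseteq> C i" if "i \<le> k" for i k using that by (rule lift_Suc_antimono_le)
      ultimately have "\<Inter>(range C) \<noteq> {}" by (intro compact_nest) auto
      then obtain x where x: "\<And>i. x \<in> C i" by auto
      have "C i \<subseteq> h i ` solid_torus" for i unfolding C_def using sub by (rule image_mono)
      then have xX: "x \<in> X" unfolding X_def using x by blast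
      have "fst (g i x) = y i" for i
      proof -
        obtain v where "v \<in> cball 0 1" "x = h i (y i, v)" using x[of i] by (auto simp: C_def)
        then show ?thesis using g_h[of "(y i, v)" i] yi(1)[of i] by auto
      qed
      then have "s x = y" by (auto simp: s_def)
      then show "y \<in> s ` X" using xX by blast
    qed
  qed
  ultimately have "homeomorphic_map (top_of_set X) (solenoid_space n) s"
    by (intro continuous_imp_homeomorphic_map) (auto simp: compact_space_subtopology)
  then show ?thesis unfolding X_def by (rule homeomorphic_map_imp_homeomorphic_space)
qed

section \<open>The core curve as a closed braid\<close>

text \<open>The strands are the \<open>n\<close>-th roots of \<open>cis (2 \<pi> t)\<close>, scaled by \<open>a\<close>.\<close>
definition root_braid :: "nat \<Rightarrow> real \<Rightarrow> nat \<Rightarrow> real \<Rightarrow> complex" where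
  "root_braid n a j t = of_real a * cis (2 * pi * (t + j) / n)"

definition cyclic_shift :: "nat \<Rightarrow> nat \<Rightarrow> nat" where
  "cyclic_shift n j = (if j < n then Suc j mod n else j)"

lemma cyclic_shift_permutes: "cyclic_shift n permutes {..<n}"
proof (rule bij_imp_permutes)
  have inj: "inj_on (cyclic_shift n) {..<n}"
    by (auto simp: inj_on_def cyclic_shift_def mod_Suc split: if_splits)
  moreover have "cyclic_shift n ` {..<n} \<subseteq> {..<n}" by (auto simp: cyclic_shift_def)
  ultimately show "bij_betw (cyclic_shift n) {..<n} {..<n}"
    by (simp add: bij_betw_def endo_inj_surj)
qed (simp add: cyclic_shift_def)

lemma cyclic_shift_transitive: "transitive_perm n (cyclic_shift n)"
  unfolding transitive_perm_def
proof (intro allI impI)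
  fix j k assume jk: "j < n" "k < n"
  have pow: "(cyclic_shift n ^^ m) j = (j + m) mod n" for m
    using jk by (induction m) (auto simp: cyclic_shift_def mod_Suc_eq)
  have "(cyclic_shift n ^^ (n - j + k)) j = k" using jk by (simp add: pow)
  then show "\<exists>m. (cyclic_shift n ^^ m) j = k" by blast
qed

lemma braid_root_braid:
  assumes "n \<ge> 1" "0 < a" "a < 1"
  shows "braid n (root_braid n a) (cyclic_shift n)"
  unfolding braid_def
proof (intro conjI allI impI ballI)
  show "continuous_on {0..1} (root_braid n a j)" for j
    unfolding root_braid_def cis_conv_exp using assms by (intro continuous_intros) auto
  show "root_braid n a j t \<in> ball 0 1" for j t
    using assms by (simp add: root_braid_def norm_mult)
  show "cyclic_shift n permutes {..<n}" by (rule cyclic_shift_permutes)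
next
  fix j k :: nat and t :: real assume jk: "j < n" "k < n" "j \<noteq> k"
  have split: "cis (2 * pi * (t + j) / n) = cis (2 * pi * t / n) * exp (2 * of_real pi * \<i> * of_nat j / of_nat n)"
    for j :: nat
  proof -
    have "2 * pi * (t + j) / n = 2 * pi * t / n + 2 * pi * j / n"
      by (simp add: add_divide_distrib distrib_left)
    moreover have "exp (2 * of_real pi * \<i> * of_nat j / of_nat n) = cis (2 * pi * j / n)"
      by (simp add: cis_conv_exp mult_ac)
    ultimately show ?thesis by (simp add: cis_mult)
  qed
  show "root_braid n a j t \<noteq> root_braid n a k t"
  proof
    assume "root_braid n a j t = root_braid n a k t"
    then have "exp (2 * of_real pi * \<i> * of_nat j / of_nat n) = (exp (2 * of_real pi * \<i> * of_nat k / of_nat n) :: complex)"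
      using assms(2) unfolding root_braid_def split by simp
    then show False using complex_root_unity_eq[OF assms(1), of j k] jk by simp
  qed
next
  fix j assume j: "j < n"
  show "root_braid n a j 1 = root_braid n a (cyclic_shift n j) 0"
  proof (cases "Suc j = n")
    case True
    then have "real n = 1 + real j" by simp
    then have "2 * pi * (1 + real j) / real n = 2 * pi" using assms(1) by (simp add: field_simps)
    then show ?thesis using True by (simp add: root_braid_def cyclic_shift_def)
  next
    case False
    then show ?thesis using j by (simp add: root_braid_def cyclic_shift_def)
  qed
qed

lemma closed_root_braid:
  assumes "n \<ge> 1"
  shows "closed_braid n (root_braid n a) = (\<lambda>\<zeta>. (\<zeta> ^ n, of_real a * \<zeta>)) ` sphere 0 1"
proof
  have pow: "cis (2 * pi * s / n) ^ n = cis (2 * pi * s)" for s :: real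
    using assms by (simp add: Complex.DeMoivre)
  have per: "cis (2 * pi * (t + j)) = cis (2 * pi * t)" for t :: real and j :: nat
    using cis_mult[of "2 * pi * t" "2 * pi * j"] by (simp add: distrib_left)
  show "closed_braid n (root_braid n a) \<subseteq> (\<lambda>\<zeta>. (\<zeta> ^ n, of_real a * \<zeta>)) ` sphere 0 1"
  proof
    fix p assume "p \<in> closed_braid n (root_braid n a)"
    then obtain j t where "p = (cis (2 * pi * t), root_braid n a j t)" by (auto simp: closed_braid_def)
    then show "p \<in> (\<lambda>\<zeta>. (\<zeta> ^ n, of_real a * \<zeta>)) ` sphere 0 1"
      using pow[of "t + j"] per[of t j]
      by (intro image_eqI[of _ _ "cis (2 * pi * (t + j) / n)"]) (auto simp: root_braid_def)
  qed
  show "(\<lambda>\<zeta>. (\<zeta> ^ n, of_real a * \<zeta>)) ` sphere 0 1 \<subseteq> closed_braid n (root_braid n a)"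
  proof (rule image_subsetI)
    fix \<zeta> :: complex assume \<zeta>: "\<zeta> \<in> sphere 0 1"
    define s where "s = n * Arg2pi \<zeta> / (2 * pi)"
    have s0: "0 \<le> s" "s < n"
      using Arg2pi_ge_0[of \<zeta>] Arg2pi_lt_2pi[of \<zeta>] assms
      by (auto simp: s_def field_simps)
    define j where "j = nat \<lfloor>s\<rfloor>"
    define t where "t = s - j"
    have j: "j < n" "t \<in> {0..1}" using s0 unfolding j_def t_def by (auto simp: nat_less_iff floor_less_iff) linarith+
    have "cis (Arg2pi \<zeta>) = \<zeta>" using Arg2pi_eq[of \<zeta>] \<zeta> by (simp add: cis_conv_exp)
    moreover have "2 * pi * s / n = Arg2pi \<zeta>" using assms by (simp add: s_def)
    ultimately have c: "cis (2 * pi * s / n) = \<zeta>" by simp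
    have "\<zeta> ^ n = cis (2 * pi * t)" using pow[of s] per[of t j] c by (simp add: t_def)
    moreover have "of_real a * \<zeta> = root_braid n a j t" by (simp add: root_braid_def t_def c)
    ultimately show "(\<zeta> ^ n, of_real a * \<zeta>) \<in> closed_braid n (root_braid n a)"
      unfolding closed_braid_def using j by blast
  qed
qed

section \<open>Cross-sectional diameters\<close>

lemma cross_diameter_bounds:
  assumes inj: "inj_on h solid_torus" and im: "h ` solid_torus \<subseteq> S3"
  shows "0 < cross_diameter h"
    and "(\<zeta>, v) \<in> solid_torus \<Longrightarrow> (\<zeta>, v') \<in> solid_torus \<Longrightarrow> dist (h (\<zeta>, v)) (h (\<zeta>, v')) \<le> cross_diameter h"
proof -
  have disc: "h ` ({\<zeta>} \<times> cball 0 1) \<subseteq> S3" if "\<zeta> \<in> sphere 0 1" for \<zeta>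
    using im that by auto
  have bdd: "bdd_above ((\<lambda>z. diameter (h ` ({z} \<times> cball 0 1))) ` sphere 0 1)"
    using disc by (intro bdd_aboveI2[where M = "diameter S3"] diameter_subset) auto
  show le: "dist (h (\<zeta>, v)) (h (\<zeta>, v')) \<le> cross_diameter h"
    if "(\<zeta>, v) \<in> solid_torus" "(\<zeta>, v') \<in> solid_torus" for \<zeta> v v'
  proof -
    have z: "\<zeta> \<in> sphere 0 1" using that by simp
    have "bounded (h ` ({\<zeta>} \<times> cball 0 1))" using bounded_sphere disc[OF z] by (rule bounded_subset)
    then have "dist (h (\<zeta>, v)) (h (\<zeta>, v')) \<le> diameter (h ` ({\<zeta>} \<times> cball 0 1))"
      using that by (intro diameter_bounded_bound) auto
    also have "\<dots> \<le> cross_diameter h"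
      unfolding cross_diameter_def using z bdd by (rule cSUP_upper)
    finally show ?thesis .
  qed
  have "h (1, 0) \<noteq> h (1, 1)"
  proof
    assume "h (1, 0) = h (1, 1)"
    then have "(1, 0) = (1 :: complex, 1 :: complex)" by (rule inj_onD[OF inj]) auto
    then show False by simp
  qed
  then have "0 < dist (h (1, 0)) (h (1, 1))" by simp
  also have "\<dots> \<le> cross_diameter h" by (rule le) auto
  finally show "0 < cross_diameter h" .
qed

lemma cross_diameter_le:
  assumes "0 \<le> e" "\<And>\<zeta> v v'. (\<zeta>, v) \<in> solid_torus \<Longrightarrow> (\<zeta>, v') \<in> solid_torus \<Longrightarrow> dist (h (\<zeta>, v)) (h (\<zeta>, v')) \<le> e"
  shows "cross_diameter h \<le> e"
  unfolding cross_diameter_def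
proof (rule cSUP_least)
  show "(sphere 0 1 :: complex set) \<noteq> {}" using norm_one by (metis dist_0_norm empty_iff mem_sphere)
  fix z :: complex assume "z \<in> sphere 0 1"
  then show "diameter (h ` ({z} \<times> cball 0 1)) \<le> e"
    using assms by (intro diameter_le) (auto simp: dist_norm)
qed

section \<open>Subgroups of the rationals\<close>

lemma mult_iso_rat_group:
  assumes "g \<noteq> 0"
  shows "rat_group\<lparr>carrier := H\<rparr> \<cong> rat_group\<lparr>carrier := (\<lambda>x. g * x) ` H\<rparr>"
proof -
  have "(\<lambda>x. g * x) \<in> iso (rat_group\<lparr>carrier := H\<rparr>) (rat_group\<lparr>carrier := (\<lambda>x. g * x) ` H\<rparr>)"
    using assms by (auto simp: iso_def hom_def rat_group_def bij_betw_def inj_on_def distrib_left)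
  then show ?thesis by (auto simp: is_iso_def)
qed

lemma rat_subgroup_closed:
  assumes "subgroup G rat_group"
  shows "0 \<in> G" "x \<in> G \<Longrightarrow> y \<in> G \<Longrightarrow> x + y \<in> G" "x \<in> G \<Longrightarrow> - x \<in> G"
    "x \<in> G \<Longrightarrow> of_int k * x \<in> G"
proof -
  interpret R: group rat_group by (rule group_rat_group)
  show 0: "0 \<in> G" and add: "\<And>x y. x \<in> G \<Longrightarrow> y \<in> G \<Longrightarrow> x + y \<in> G"
    using subgroup.one_closed[OF assms] subgroup.m_closed[OF assms] by (auto simp: rat_group_def)
  have inv: "inv\<^bsub>rat_group\<^esub> x = - x" for x
    by (rule R.inv_equality) (auto simp: rat_group_def)
  show neg: "- x \<in> G" if "x \<in> G" for x
    using subgroup.m_inv_closed[OF assms that] by (simp add: inv)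
  have nat: "of_nat m * x \<in> G" if "x \<in> G" for m x
    using 0 add that by (induction m) (auto simp: distrib_right)
  show "of_int k * x \<in> G" if "x \<in> G"
    using nat[OF that, of "nat k"] neg[OF nat[OF that, of "nat (- k)"]]
    by (cases "k \<ge> 0") auto
qed

lemma unit_fraction_in_subgroup:
  assumes G: "subgroup G rat_group" "1 \<in> G" and x: "of_int a / of_int b \<in> G" and "coprime a b" "b \<noteq> 0"
  shows "1 / of_int b \<in> G"
proof -
  obtain u v where "u * a + v * b = 1"
    using bezout_int[of a b] \<open>coprime a b\<close> by (metis coprime_imp_gcd_eq_1)
  then have "(of_int u * of_int a + of_int v * of_int b :: rat) = 1"
    by (metis of_int_1 of_int_add of_int_mult)
  then have "of_int u * (of_int a / of_int b) + of_int v * 1 = (1 / of_int b :: rat)"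
    using \<open>b \<noteq> 0\<close> by (simp add: field_simps)
  moreover have "of_int u * (of_int a / of_int b) + of_int v * 1 \<in> G"
    by (intro rat_subgroup_closed[OF G(1)] x G(2))
  ultimately show ?thesis by metis
qed

text \<open>A subgroup containing 1 contains \<open>1 / b\<close> along with every reduced fraction \<open>a / b\<close>, by Bezout. The
  denominators of its unit fractions are closed under least common multiples, again by Bezout. So
  the group is the union of the cyclic groups generated by \<open>1 / N i\<close>, where \<open>N i\<close> is the least common
  multiple of those denominators that are at most \<open>i\<close>, and the quotients \<open>N i / N (i - 1)\<close> form the
  defining sequence.\<close>
lemma fractions_group_exhausts:
  assumes G: "subgroup G rat_group" "1 \<in> G"
  obtains n where "defining_sequence n" "fractions_group n = G"
proof -
  define D where "D = {d :: nat. d > 0 \<and> 1 / of_nat d \<in> G}"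
  have D_lcm: "lcm c d \<in> D" if cd: "c \<in> D" "d \<in> D" for c d
  proof -
    define l where "l = lcm c d"
    have pos: "c > 0" "d > 0" "l > 0" using cd by (auto simp: D_def l_def lcm_pos_nat)
    obtain x y where xy: "l = c * x" "l = d * y" unfolding l_def by (meson dvd_def dvd_lcm1 dvd_lcm2)
    have "coprime x y"
    proof (rule coprimeI)
      fix e assume "e dvd x" "e dvd y"
      then obtain x' y' where e: "x = e * x'" "y = e * y'" by (auto simp: dvd_def)
      have "e > 0" using pos xy e by (cases e) auto
      have "c * x' = d * y'" using xy e \<open>e > 0\<close>
        by (metis mult.left_commute mult_cancel1 neq0_conv)
      then have "l dvd c * x'" unfolding l_def by (metis dvd_triv_left lcm_least)
      then have "c * (e * x') dvd c * x'" using xy(1) e(1) by metis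
      then show "is_unit e" using pos xy e by (auto simp: dvd_mult_cancel1 dest!: dvd_imp_le)
    qed
    then obtain u v where "u * int x + v * int y = 1"
      using bezout_int[of "int x" "int y"] by (metis coprime_int_iff coprime_imp_gcd_eq_1)
    then have "(of_int u * of_nat x + of_int v * of_nat y :: rat) = 1"
      by (metis of_int_1 of_int_add of_int_mult of_int_of_nat_eq)
    moreover have "(1 / of_nat c :: rat) = of_nat x / of_nat l" "(1 / of_nat d :: rat) = of_nat y / of_nat l"
      using pos xy by (simp_all add: field_simps flip: of_nat_mult)
    ultimately have "of_int u * (1 / of_nat c) + of_int v * (1 / of_nat d) = (1 / of_nat l :: rat)"
      by (metis (no_types, opaque_lifting) add_divide_distrib times_divide_eq_right)
    moreover have "of_int u * (1 / of_nat c) + of_int v * (1 / of_nat d) \<in> G"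
      using cd by (intro rat_subgroup_closed[OF G(1)]) (auto simp: D_def)
    ultimately show ?thesis using pos unfolding D_def l_def by auto
  qed
  define N where "N i = Lcm {d \<in> D. d \<le> i}" for i
  have N_Suc: "N (Suc i) = (if Suc i \<in> D then lcm (Suc i) (N i) else N i)" for i
  proof -
    have "{d \<in> D. d \<le> Suc i} = (if Suc i \<in> D then insert (Suc i) {d \<in> D. d \<le> i} else {d \<in> D. d \<le> i})"
      by (auto simp: le_Suc_eq)
    then show ?thesis by (simp add: N_def)
  qed
  have N_0: "N 0 = 1"
  proof -
    have "{d \<in> D. d \<le> 0} = {}" by (auto simp: D_def)
    then show ?thesis unfolding N_def by (simp only: Lcm_empty)
  qed
  have N_D: "N i \<in> D" for i
  proof (induction i)
    case 0
    show ?case using G(2) by (simp add: N_0 D_def)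
  qed (auto simp: N_Suc D_lcm)
  have N_pos: "N i > 0" for i using N_D[of i] by (simp add: D_def)
  have dvd: "N i dvd N (Suc i)" for i by (simp add: N_Suc)
  define n where "n i = N i div N (i - 1)" for i
  have prod: "stage_degree n i = N i" for i
  proof (induction i)
    case (Suc i)
    then show ?case using dvd[of i] by (simp add: n_def)
  qed (simp add: N_0)
  have "defining_sequence n"
    unfolding defining_sequence_def
  proof (intro allI impI)
    fix i :: nat assume "1 \<le> i"
    then obtain k where "i = Suc k" by (cases i) auto
    then show "1 \<le> n i" using dvd[of k] N_pos[of i] N_pos[of k]
      by (simp add: n_def Suc_le_eq div_greater_zero_iff dvd_imp_le)
  qed
  moreover have "fractions_group n = G"
  proof
    show "fractions_group n \<subseteq> G"
    proof
      fix q assume "q \<in> fractions_group n"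
      then obtain i k where "q * of_nat (N i) = of_int k"
        unfolding fractions_group_def prod by (auto simp: Ints_def)
      then have "q = of_int k * (1 / of_nat (N i))" using N_pos[of i] by (simp add: field_simps)
      moreover have "1 / of_nat (N i) \<in> G" using N_D[of i] by (simp add: D_def)
      ultimately show "q \<in> G" using rat_subgroup_closed(4)[OF G(1)] by metis
    qed
    show "G \<subseteq> fractions_group n"
    proof
      fix q assume q: "q \<in> G"
      obtain a b where ab: "q = of_int a / of_int b" "b > 0" "coprime a b"
        by (metis quotient_of_coprime quotient_of_denom_pos quotient_of_div surj_pair)
      then have "1 / of_int b \<in> G" using unit_fraction_in_subgroup[OF G, of a b] q by auto
      then have "nat b \<in> D" using ab(2) by (simp add: D_def)
      then have "nat b dvd N (nat b)" unfolding N_def by (intro dvd_Lcm) simp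
      then obtain m where m: "N (nat b) = nat b * m" by (auto simp: dvd_def)
      have "q * of_nat (N (nat b)) = of_int (a * int m)"
        using ab(1,2) by (simp add: m)
      then have "q * of_nat (N (nat b)) \<in> \<int>" by (metis Ints_of_int)
      then show "q \<in> fractions_group n" unfolding fractions_group_def prod by blast
    qed
  qed
  ultimately show ?thesis using that by blast
qed

lemma nontrivial_rat_subgroup_iso_fractions_group:
  assumes G: "subgroup G rat_group" "G \<noteq> {0}"
  obtains n where "defining_sequence n"
    "rat_group\<lparr>carrier := fractions_group n\<rparr> \<cong> rat_group\<lparr>carrier := G\<rparr>"
proof -
  obtain g where g: "g \<in> G" "g \<noteq> 0" using G rat_subgroup_closed(1)[OF G(1)] by blast
  define H where "H = {x. g * x \<in> G}"
  have "subgroup H rat_group"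
  proof -
    interpret R: group rat_group by (rule group_rat_group)
    have inv: "inv\<^bsub>rat_group\<^esub> x = - x" for x
      by (rule R.inv_equality) (auto simp: rat_group_def)
    note cl = rat_subgroup_closed[OF G(1)]
    show ?thesis
    proof
      fix x y assume "x \<in> H" "y \<in> H"
      then show "x \<otimes>\<^bsub>rat_group\<^esub> y \<in> H" using cl(2)[of "g * x" "g * y"]
        by (simp add: H_def rat_group_def distrib_left)
    next
      fix x assume "x \<in> H"
      then show "inv\<^bsub>rat_group\<^esub> x \<in> H" unfolding inv using cl(3)[of "g * x"] by (simp add: H_def)
    qed (use cl(1) in \<open>auto simp: H_def rat_group_def\<close>)
  qed
  moreover have "1 \<in> H" using g by (simp add: H_def)
  ultimately obtain n where n: "defining_sequence n" "fractions_group n = H"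
    by (rule fractions_group_exhausts)
  have "(\<lambda>x. g * x) ` H = G"
  proof
    show "G \<subseteq> (\<lambda>x. g * x) ` H"
    proof
      fix x assume "x \<in> G"
      then show "x \<in> (\<lambda>x. g * x) ` H" using g by (intro image_eqI[of _ _ "x / g"]) (auto simp: H_def)
    qed
  qed (auto simp: H_def)
  then show ?thesis using that[OF n(1)] mult_iso_rat_group[OF g(2), of H] n(2) by simp
qed

section \<open>Towers of unknotted solid tori\<close>

lemma std_torus_continuous: "continuous_on X std_torus"
proof -
  have "continuous_on X (\<lambda>p :: complex \<times> complex. (4/5 * snd p, fst p))"
    by (intro continuous_intros)
  then have "continuous_on X (\<lambda>p. join_map (4/5 * snd p, fst p))"
    by (rule continuous_on_compose2[OF continuous_join_map[of UNIV] _ subset_UNIV])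
  then show ?thesis by (simp add: std_torus_def case_prod_beta)
qed

lemma inj_std_torus: "inj_on std_torus solid_torus"
proof (rule inj_onI)
  fix p q :: "complex \<times> complex"
  assume pq: "p \<in> solid_torus" "q \<in> solid_torus" "std_torus p = std_torus q"
  have n: "cmod (4/5 * snd p) < 1" "cmod (4/5 * snd q) < 1" using pq(1,2) by (auto simp: mem_Times_iff norm_mult)
  have "join_map (4/5 * snd p, fst p) = join_map (4/5 * snd q, fst q)"
    using pq(3) by (simp only: std_torus_def case_prod_beta)
  then show "p = q" using n by (subst (asm) join_map_eq_iff) (auto simp: prod_eq_iff)
qed

lemma torus_complement_eq: "torus_complement = S3C - std_torus ` solid_torus"
  unfolding std_torus_image torus_complement_def by auto

text \<open>\<open>\<Psi>\<close> and its inverse \<open>\<Psi>'\<close> describe the torus that follows the image of the standard torus under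
  \<open>\<Phi>\<close>; the map \<open>f\<close> expresses the inclusion of the new torus in the parametrizations of both.\<close>
definition cable_step :: "nat \<Rightarrow> (complex \<times> complex \<Rightarrow> real^4) \<Rightarrow> (complex \<times> complex \<Rightarrow> real^4) \<Rightarrow>
    (real^4 \<Rightarrow> complex \<times> complex) \<Rightarrow> (complex \<times> complex \<Rightarrow> complex \<times> complex) \<Rightarrow> bool" where
  "cable_step n \<Phi> \<Psi> \<Psi>' f \<longleftrightarrow>
     (\<forall>p \<in> solid_torus. \<Psi> (std_torus p) = \<Phi> (std_torus (f p)) \<and>
        fst (f p) = fst p ^ n \<and> snd (f p) \<in> ball 0 1) \<and>
     (\<exists>a. 0 < a \<and> a < 1 \<and> (\<forall>\<zeta> \<in> circ. f (\<zeta>, 0) = (\<zeta> ^ n, of_real a * \<zeta>))) \<and>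
     (\<exists>k. \<forall>\<eta> \<in> circ. snd (\<Psi>' (\<Phi> (0, \<eta>))) = k * \<eta> ^ n) \<and>
     cross_diameter (\<Psi> \<circ> std_torus) < cross_diameter (\<Phi> \<circ> std_torus) / 2"

lemma std_torus_subset: "std_torus ` solid_torus \<subseteq> S3C"
  by (auto simp: std_torus_image)

lemma torus_embedding:
  assumes \<Phi>: "homeomorphism S3C S3 \<Phi> \<Phi>'"
  shows "continuous_on solid_torus (\<Phi> \<circ> std_torus)" "inj_on (\<Phi> \<circ> std_torus) solid_torus"
    "(\<Phi> \<circ> std_torus) ` solid_torus \<subseteq> S3"
proof -
  have inj: "inj_on \<Phi> S3C" using homeomorphism_apply1[OF \<Phi>] by (metis inj_onI)
  show "continuous_on solid_torus (\<Phi> \<circ> std_torus)"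
    using \<Phi> std_torus_subset
    by (intro continuous_on_compose std_torus_continuous) (auto simp: homeomorphism_def intro: continuous_on_subset)
  show "inj_on (\<Phi> \<circ> std_torus) solid_torus"
    using inj_std_torus inj_on_subset[OF inj std_torus_subset] by (rule comp_inj_on)
  have "\<Phi> ` S3C = S3" using \<Phi> by (simp add: homeomorphism_def)
  then show "(\<Phi> \<circ> std_torus) ` solid_torus \<subseteq> S3"
    using std_torus_subset by (metis image_comp image_mono)
qed

text \<open>The cabling is performed in standard position, before applying \<open>\<Phi>\<close>. Uniform continuity of \<open>\<Phi>\<close> on
  the standard torus determines how thin it has to be for the diameters to be halved.\<close>
lemma cable_step_exists:
  assumes \<Phi>: "homeomorphism S3C S3 \<Phi> \<Phi>'" and n: "n \<ge> 1"
  shows "\<exists>\<Psi> \<Psi>' f. homeomorphism S3C S3 \<Psi> \<Psi>' \<and> cable_step n \<Phi> \<Psi> \<Psi>' f"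
proof -
  let ?h = "\<Phi> \<circ> std_torus"
  note h = torus_embedding[OF \<Phi>]
  define c where "c = cross_diameter ?h"
  have c: "0 < c" unfolding c_def by (rule cross_diameter_bounds(1)[OF h(2,3)])
  have "uniformly_continuous_on solid_torus ?h"
    using h(1) by (intro compact_uniformly_continuous compact_Times) auto
  then obtain \<mu> where \<mu>: "\<mu> > 0"
    "\<And>p q. p \<in> solid_torus \<Longrightarrow> q \<in> solid_torus \<Longrightarrow> dist q p < \<mu> \<Longrightarrow> dist (?h q) (?h p) < c / 4"
    using c unfolding uniformly_continuous_on_def by (metis divide_pos_pos zero_less_numeral)
  obtain \<phi> \<phi>' f a k where f:
    "homeomorphism S3C S3C \<phi> \<phi>'"
    "\<And>p. p \<in> solid_torus \<Longrightarrow> \<phi> (std_torus p) = std_torus (f p)"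
    "\<And>\<zeta> v. (\<zeta>, v) \<in> solid_torus \<Longrightarrow> fst (f (\<zeta>, v)) = \<zeta> ^ n"
    "\<And>p. p \<in> solid_torus \<Longrightarrow> snd (f p) \<in> ball 0 1"
    "0 < a" "a < (1::real)" "\<And>\<zeta>. \<zeta> \<in> circ \<Longrightarrow> f (\<zeta>, 0) = (\<zeta> ^ n, of_real a * \<zeta>)"
    "\<And>\<zeta> v v'. (\<zeta>, v) \<in> solid_torus \<Longrightarrow> (\<zeta>, v') \<in> solid_torus \<Longrightarrow> dist (f (\<zeta>, v)) (f (\<zeta>, v')) < \<mu>"
    "\<And>\<eta>. \<eta> \<in> circ \<Longrightarrow> snd (\<phi>' (0, \<eta>)) = k * \<eta> ^ n"
    by (rule cabling[OF n \<mu>(1)], rule that)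
  have ff: "fst (f p) = fst p ^ n" if "p \<in> solid_torus" for p
    using f(3)[of "fst p" "snd p"] that by simp
  have f_in: "f p \<in> solid_torus" if "p \<in> solid_torus" for p
    using ff[OF that] f(4)[OF that] that by (auto simp: mem_Times_iff norm_power)
  define \<Psi> where "\<Psi> = \<Phi> \<circ> \<phi>"
  define \<Psi>' where "\<Psi>' = \<phi>' \<circ> \<Phi>'"
  have \<Psi>: "homeomorphism S3C S3 \<Psi> \<Psi>'"
    unfolding \<Psi>_def \<Psi>'_def by (rule homeomorphism_compose[OF f(1) \<Phi>])
  have step: "\<Psi> (std_torus p) = \<Phi> (std_torus (f p))" if "p \<in> solid_torus" for p
    using f(2)[OF that] by (simp add: \<Psi>_def)
  have "cross_diameter (\<Psi> \<circ> std_torus) \<le> c / 4"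
  proof (rule cross_diameter_le)
    fix \<zeta> v v' assume v: "(\<zeta>, v) \<in> solid_torus" "(\<zeta>, v') \<in> solid_torus"
    have "dist (?h (f (\<zeta>, v))) (?h (f (\<zeta>, v'))) < c / 4"
      using v by (intro \<mu>(2) f_in f(8))
    then show "dist ((\<Psi> \<circ> std_torus) (\<zeta>, v)) ((\<Psi> \<circ> std_torus) (\<zeta>, v')) \<le> c / 4"
      using step[OF v(1)] step[OF v(2)] by simp
  qed (use c in simp)
  then have "cross_diameter (\<Psi> \<circ> std_torus) < cross_diameter ?h / 2"
    using c unfolding c_def by linarith
  moreover have "snd (\<Psi>' (\<Phi> (0, \<eta>))) = k * \<eta> ^ n" if "\<eta> \<in> circ" for \<eta>
  proof -
    have "(0, \<eta>) \<in> S3C" using that by (simp add: norm_prod_def)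
    then have "\<Phi>' (\<Phi> (0, \<eta>)) = (0, \<eta>)" by (rule homeomorphism_apply1[OF \<Phi>])
    then show ?thesis using f(9)[OF that] by (simp add: \<Psi>'_def)
  qed
  ultimately have "cable_step n \<Phi> \<Psi> \<Psi>' f"
    unfolding cable_step_def using step ff f(4-7) by blast
  then show ?thesis using \<Psi> by blast
qed

text \<open>The tower starts from a linear isometry of \<open>\<complex>\<^sup>2\<close> with \<open>\<real>\<^sup>4\<close>.\<close>
lemma cable_tower_exists:
  assumes n: "defining_sequence n"
  obtains \<Phi> \<Phi>' f where "\<And>i. homeomorphism S3C S3 (\<Phi> i) (\<Phi>' i)"
    "\<And>i :: nat. cable_step (n (Suc i)) (\<Phi> i) (\<Phi> (Suc i)) (\<Phi>' (Suc i)) (f i)"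
proof -
  have "DIM(complex \<times> complex) = DIM(real^4)" by simp
  then obtain L :: "complex \<times> complex \<Rightarrow> real^4" and L' where L: "linear L" "linear L'"
    "\<And>x. norm (L x) = norm x" "\<And>y. norm (L' y) = norm y" "\<And>x. L' (L x) = x" "\<And>y. L (L' y) = y"
    using isomorphisms_UNIV_UNIV[where 'M = "complex \<times> complex" and 'N = "real^4"] by metis
  have "homeomorphism S3C S3 L L'"
    using L by (intro homeomorphismI) (auto simp: linear_continuous_on linear_conv_bounded_linear)
  then have "\<exists>s. \<forall>i. homeomorphism S3C S3 (fst (s i)) (snd (s i)) \<and>
      (\<exists>f. cable_step (n (Suc i)) (fst (s i)) (fst (s (Suc i))) (snd (s (Suc i))) f)"
  proof (intro dependent_nat_choice[where P = "\<lambda>i s. homeomorphism S3C S3 (fst s) (snd s)"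
        and Q = "\<lambda>i s s'. \<exists>f. cable_step (n (Suc i)) (fst s) (fst s') (snd s') f"])
    show "\<exists>s. homeomorphism S3C S3 (fst s) (snd s)" if "homeomorphism S3C S3 L L'"
      using that by (intro exI[of _ "(L, L')"]) simp
    fix s :: "(complex \<times> complex \<Rightarrow> real^4) \<times> (real^4 \<Rightarrow> complex \<times> complex)" and i
    assume "homeomorphism S3C S3 (fst s) (snd s)"
    moreover have "n (Suc i) \<ge> 1" using n by (simp add: defining_sequence_def)
    ultimately obtain \<Psi> \<Psi>' f where "homeomorphism S3C S3 \<Psi> \<Psi>'" "cable_step (n (Suc i)) (fst s) \<Psi> \<Psi>' f"
      using cable_step_exists by blast
    then show "\<exists>s'. homeomorphism S3C S3 (fst s') (snd s') \<and>
        (\<exists>f. cable_step (n (Suc i)) (fst s) (fst s') (snd s') f)"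
      by (intro exI[of _ "(\<Psi>, \<Psi>')"]) auto
  qed
  then obtain s where s: "\<And>i. homeomorphism S3C S3 (fst (s i)) (snd (s i))"
    "\<And>i. \<exists>f. cable_step (n (Suc i)) (fst (s i)) (fst (s (Suc i))) (snd (s (Suc i))) f" by blast
  then obtain f where "\<And>i. cable_step (n (Suc i)) (fst (s i)) (fst (s (Suc i))) (snd (s (Suc i))) (f i)"
    by metis
  then show ?thesis using that[of "\<lambda>i. fst (s i)" "\<lambda>i. snd (s i)" f] s(1) by simp
qed

locale cable_tower =
  fixes n :: "nat \<Rightarrow> nat" and \<Phi> \<Phi>' and f
  assumes n: "defining_sequence n"
    and homeo: "\<And>i. homeomorphism S3C S3 (\<Phi> i) (\<Phi>' i)"
    and step: "\<And>i. cable_step (n (Suc i)) (\<Phi> i) (\<Phi> (Suc i)) (\<Phi>' (Suc i)) (f i)"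
begin

definition h :: "nat \<Rightarrow> complex \<times> complex \<Rightarrow> real^4" where
  "h i = \<Phi> i \<circ> std_torus"

lemma n_ge_1: "n (Suc i) \<ge> 1"
  using n by (simp add: defining_sequence_def)

lemmas h_embedding = torus_embedding[OF homeo, folded h_def]

lemma h_nest:
  assumes "p \<in> solid_torus"
  shows "h (Suc i) p = h i (f i p)" "fst (f i p) = fst p ^ n (Suc i)" "snd (f i p) \<in> ball 0 1"
    "f i p \<in> solid_torus"
proof -
  show 1: "h (Suc i) p = h i (f i p)" "fst (f i p) = fst p ^ n (Suc i)" "snd (f i p) \<in> ball 0 1"
    using step[of i] assms by (auto simp: cable_step_def h_def)
  show "f i p \<in> solid_torus"
    using 1(2,3) assms by (auto simp: mem_Times_iff norm_power)
qed

lemma h_tame: "tame_solid_torus (h i)"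
proof -
  have "embedding_map (top_of_set solid_torus) (top_of_set S3) (h i)"
    using h_embedding[of i]
    by (intro continuous_imp_embedding_map)
      (auto simp: compact_space_subtopology compact_Times Hausdorff_space_subtopology)
  moreover have "tame (h i ` solid_torus)"
    using tame_standard_torus_image[OF homeo[of i]] by (simp add: h_def image_comp)
  ultimately show ?thesis by (simp add: tame_solid_torus_def)
qed

lemma open_torus: "openin (top_of_set S3) (\<Phi> i ` {p \<in> S3C. cmod (snd p) < 4/5})"
proof (rule homeomorphism_imp_open_map[OF homeo])
  have "openin (top_of_set S3C) (S3C \<inter> (\<lambda>p. cmod (snd p)) -` {..< 4/5})"
    by (rule continuous_openin_preimage_gen) (auto intro!: continuous_intros)
  moreover have "S3C \<inter> (\<lambda>p. cmod (snd p)) -` {..< 4/5} = {p \<in> S3C. cmod (snd p) < 4/5}" by auto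
  ultimately show "openin (top_of_set S3C) {p \<in> S3C. cmod (snd p) < 4/5}" by simp
qed

lemma h_interior:
  "h (Suc i) ` solid_torus \<subseteq> (top_of_set S3) interior_of (h i ` solid_torus)"
proof -
  let ?W = "{p \<in> S3C. cmod (snd p) < 4/5}"
  have "?W \<subseteq> std_torus ` solid_torus" unfolding std_torus_image by auto
  then have "\<Phi> i ` ?W \<subseteq> h i ` solid_torus" unfolding h_def image_comp[symmetric] by (rule image_mono)
  then have "\<Phi> i ` ?W \<subseteq> (top_of_set S3) interior_of (h i ` solid_torus)"
    using open_torus by (rule interior_of_maximal)
  moreover have "h (Suc i) p \<in> \<Phi> i ` ?W" if p: "p \<in> solid_torus" for p
  proof -
    have "std_torus (f i p) \<in> S3C" using std_torus_subset h_nest(4)[OF p] by blast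
    moreover have "cmod (snd (std_torus (f i p))) < 4/5"
      using h_nest(3)[OF p, of i] by (simp add: std_torus_def join_map_def case_prod_beta norm_mult)
    moreover have "h (Suc i) p = \<Phi> i (std_torus (f i p))"
      using h_nest(1)[OF p, of i] by (simp add: h_def)
    ultimately show ?thesis by (intro image_eqI[of _ _ "std_torus (f i p)"]) blast+
  qed
  ultimately show ?thesis by blast
qed

lemma h_braid:
  "\<exists>b \<sigma>. braid (n (Suc i)) b \<sigma> \<and> transitive_perm (n (Suc i)) \<sigma> \<and>
     tubular_nbhd_of (h (Suc i)) (h i ` closed_braid (n (Suc i)) b)"
proof -
  obtain a where a: "0 < a" "a < 1" "\<And>\<zeta>. \<zeta> \<in> circ \<Longrightarrow> f i (\<zeta>, 0) = (\<zeta> ^ n (Suc i), of_real a * \<zeta>)"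
    using step[of i] unfolding cable_step_def by blast
  have "h (Suc i) ` (circ \<times> {0}) = (\<lambda>\<zeta>. h (Suc i) (\<zeta>, 0)) ` circ" by auto
  also have "\<dots> = (\<lambda>\<zeta>. h i (\<zeta> ^ n (Suc i), of_real a * \<zeta>)) ` circ"
  proof (intro image_cong refl)
    fix \<zeta> :: complex assume z: "\<zeta> \<in> circ"
    then have "(\<zeta>, 0) \<in> solid_torus" by simp
    then show "h (Suc i) (\<zeta>, 0) = h i (\<zeta> ^ n (Suc i), of_real a * \<zeta>)"
      using h_nest(1)[of "(\<zeta>, 0)" i] a(3)[OF z] by simp
  qed
  also have "\<dots> = h i ` closed_braid (n (Suc i)) (root_braid (n (Suc i)) a)"
    unfolding closed_root_braid[OF n_ge_1] by (simp only: image_image)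
  finally have "tubular_nbhd_of (h (Suc i)) (h i ` closed_braid (n (Suc i)) (root_braid (n (Suc i)) a))"
    by (simp add: tubular_nbhd_of_def)
  then show ?thesis using braid_root_braid[OF n_ge_1 a(1,2)] cyclic_shift_transitive by blast
qed

lemma h_diameter: "cross_diameter (h (Suc i)) < cross_diameter (h i) / 2"
  using step[of i] by (simp add: cable_step_def h_def)

lemma nested_braided_tori_h: "nested_braided_tori n h"
  unfolding nested_braided_tori_def using h_tame h_interior h_braid h_diameter by blast

lemma cross_diameter_small:
  assumes "e > 0"
  shows "\<exists>i. cross_diameter (h i) < e"
proof -
  have le: "cross_diameter (h i) \<le> cross_diameter (h 0) * (1/2) ^ i" for i
  proof (induction i)
    case (Suc i)
    then show ?case using h_diameter[of i] by simp
  qed simp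
  have "(\<lambda>i. cross_diameter (h 0) * (1/2) ^ i) \<longlonglongrightarrow> cross_diameter (h 0) * 0"
    by (intro tendsto_mult tendsto_const LIMSEQ_realpow_zero) auto
  then have "\<forall>\<^sub>F i in sequentially. cross_diameter (h 0) * (1/2) ^ i < e"
    using assms by (intro order_tendstoD) auto
  then obtain i where "cross_diameter (h 0) * (1/2) ^ i < e" using eventually_happens by fastforce
  then show ?thesis using le[of i] by (intro exI[of _ i]) linarith
qed

lemma intersection_homeomorphic:
  "top_of_set (\<Inter>i. h i ` solid_torus) homeomorphic_space solenoid_space n"
proof (rule solenoid_intersection[where f = f])
  fix e :: real assume "e > 0"
  then obtain i where "cross_diameter (h i) < e" using cross_diameter_small by blast
  then show "\<exists>i. \<forall>\<zeta> v v'. (\<zeta>, v) \<in> solid_torus \<longrightarrow> (\<zeta>, v') \<in> solid_torus \<longrightarrow>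
      dist (h i (\<zeta>, v)) (h i (\<zeta>, v')) < e"
    using cross_diameter_bounds(2)[OF h_embedding(2,3)[of i]] by (meson le_less_trans)
next
  show "continuous_on solid_torus (h i)" "inj_on (h i) solid_torus" for i
    by (rule h_embedding)+
  show "f i p \<in> solid_torus" "h (Suc i) p = h i (f i p)" "fst (f i p) = fst p ^ n (Suc i)"
    if "p \<in> solid_torus" for i p
    using h_nest[OF that, of i] by blast+
qed

definition U :: "nat \<Rightarrow> (real^4) set" where
  "U i = S3 - h i ` solid_torus"

lemma U_eq: "U i = \<Phi> i ` torus_complement"
proof -
  have inj: "inj_on (\<Phi> i) S3C"
    by (rule inj_on_inverseI[where g = "\<Phi>' i"]) (rule homeomorphism_apply1[OF homeo])
  have "\<Phi> i ` torus_complement = \<Phi> i ` S3C - \<Phi> i ` std_torus ` solid_torus"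
    unfolding torus_complement_eq
    by (rule inj_on_image_set_diff[OF inj Diff_subset std_torus_subset])
  also have "\<Phi> i ` S3C = S3" using homeo[of i] by (simp add: homeomorphism_def)
  finally show ?thesis by (simp add: U_def h_def image_comp)
qed

lemma U_homeo: "homeomorphism torus_complement (U i) (\<Phi> i) (\<Phi>' i)"
  by (rule homeomorphism_of_subsets[OF homeo]) (auto simp: U_eq torus_complement_def U_def)

lemma loops_pull:
  assumes "p \<in> loops (U i) x"
  shows "\<Phi>' i \<circ> p \<in> loops torus_complement (\<Phi>' i x)"
  using assms homeomorphism_cont2[OF U_homeo[of i]] homeomorphism_image2[OF U_homeo[of i]]
  by (intro loops_continuous_image[of p "U i"]) auto

lemma loops_push:
  assumes "p \<in> loops torus_complement y"
  shows "\<Phi> i \<circ> p \<in> loops (U i) (\<Phi> i y)"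
  using assms homeomorphism_cont1[OF U_homeo[of i]] homeomorphism_image1[OF U_homeo[of i]]
  by (intro loops_continuous_image[of p torus_complement]) auto

lemma push_pull:
  assumes "p \<in> loops (U i) x" "t \<in> {0..1}"
  shows "\<Phi> i (\<Phi>' i (p t)) = p t"
proof -
  have "p t \<in> U i" using assms by (auto simp: loops_def path_image_def)
  then show ?thesis using U_homeo[of i] by (simp add: homeomorphism_def)
qed

definition \<theta> :: "nat \<Rightarrow> real^4 \<Rightarrow> complex" where
  "\<theta> i = snd \<circ> \<Phi>' i"

lemma wind_\<theta>: "wind (\<theta> i) p = wind snd (\<Phi>' i \<circ> p)"
  by (simp add: wind_def \<theta>_def o_assoc)

lemma U_Suc: "U i \<subseteq> U (Suc i)"
proof -
  have "h (Suc i) ` solid_torus \<subseteq> h i ` solid_torus" using h_nest(1,4) by blast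
  then show ?thesis by (auto simp: U_def)
qed

text \<open>The winding numbers at each stage are pulled back from the complement of the standard
  torus. A compact set disjoint from the intersection is disjoint from one of the tori, as otherwise
  its intersections with them would be nested nonempty compact sets.\<close>

sublocale winding_tower U "S3 - (\<Inter>i. h i ` solid_torus)" \<theta> n
proof
  show "n (Suc i) > 0" for i using n_ge_1[of i] by simp
  show "U i \<subseteq> U (Suc i)" for i by (rule U_Suc)
  show "U i \<subseteq> S3 - (\<Inter>i. h i ` solid_torus)" for i by (auto simp: U_def)
  show "continuous_on (U i) (\<theta> i)" for i
    unfolding \<theta>_def using U_homeo[of i]
    by (intro continuous_on_compose) (auto simp: homeomorphism_def intro: continuous_intros)
  show "\<theta> i x \<noteq> 0" if "x \<in> U i" for i x
  proof -
    have "\<Phi>' i x \<in> torus_complement" using U_homeo[of i] that by (auto simp: homeomorphism_def)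
    then show ?thesis using torus_complement_fst(2) by (simp add: \<theta>_def)
  qed
  show "\<exists>i. K \<subseteq> U i" if K: "compact K" "K \<subseteq> S3 - (\<Inter>i. h i ` solid_torus)" for K
  proof (rule ccontr)
    assume no: "\<not> (\<exists>i. K \<subseteq> U i)"
    define C where "C i = K \<inter> h i ` solid_torus" for i
    have "compact (h i ` solid_torus)" for i
      using h_embedding(1) by (intro compact_continuous_image compact_Times) auto
    then have "compact (C i)" for i unfolding C_def using K(1) by (intro compact_Int)
    moreover have "C i \<noteq> {}" for i using no K(2) unfolding C_def U_def by blast
    moreover have "C (Suc i) \<subseteq> C i" for i unfolding C_def using h_nest(1,4) by blast
    then have "C k \<subseteq> C i" if "i \<le> k" for i k using that by (rule lift_Suc_antimono_le)
    ultimately have "\<Inter>(range C) \<noteq> {}" by (intro compact_nest) auto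
    then show False using K(2) unfolding C_def by blast
  qed
  show "homotopic_paths (U i) p q"
    if pq: "p \<in> loops (U i) x" "q \<in> loops (U i) x" "wind (\<theta> i) p = wind (\<theta> i) q" for i x p q
  proof -
    have "homotopic_paths torus_complement (\<Phi>' i \<circ> p) (\<Phi>' i \<circ> q)"
      using torus_complement_faithful[OF loops_pull[OF pq(1)] loops_pull[OF pq(2)]] pq(3) by (simp add: wind_\<theta>)
    then have hp: "homotopic_paths (U i) (\<Phi> i \<circ> (\<Phi>' i \<circ> p)) (\<Phi> i \<circ> (\<Phi>' i \<circ> q))"
      using U_homeo[of i]
      by (intro homotopic_paths_continuous_image[of torus_complement]) (auto simp: homeomorphism_def)
    have "homotopic_paths (U i) r (\<Phi> i \<circ> (\<Phi>' i \<circ> r))" if "r \<in> loops (U i) x" for r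
      using that push_pull[OF that] by (intro homotopic_paths_eq) (auto simp: loops_def)
    then show ?thesis using hp pq(1,2) by (meson homotopic_paths_sym homotopic_paths_trans)
  qed
  show "\<exists>p \<in> loops (U i) x. wind (\<theta> i) p = of_int k" if x: "x \<in> U i" for i x k
  proof -
    have y: "\<Phi>' i x \<in> torus_complement" "\<Phi> i (\<Phi>' i x) = x"
      using U_homeo[of i] x by (auto simp: homeomorphism_def)
    obtain p where p: "p \<in> loops torus_complement (\<Phi>' i x)" "wind snd p = of_int k"
      using torus_complement_full[OF y(1)] by blast
    have "\<Phi> i \<circ> p \<in> loops (U i) x" using loops_push[OF p(1), of i] y(2) by simp
    moreover have "wind (\<theta> i) (\<Phi> i \<circ> p) = wind snd p"
      unfolding wind_\<theta> unfolding wind_def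
    proof (rule winding_number_cong)
      fix t :: real assume "0 \<le> t" "t \<le> 1"
      then have "p t \<in> torus_complement" using p(1) by (auto simp: loops_def path_image_def)
      then show "(snd \<circ> (\<Phi>' i \<circ> (\<Phi> i \<circ> p))) t = (snd \<circ> p) t"
        using U_homeo[of i] by (simp add: homeomorphism_def)
    qed
    ultimately show ?thesis using p(2) by auto
  qed
  show "wind (\<theta> (Suc i)) p = of_nat (n (Suc i)) * wind (\<theta> i) p" if p: "p \<in> loops (U i) x" for i x p
  proof -
    obtain k where k: "\<And>\<eta>. \<eta> \<in> circ \<Longrightarrow> snd (\<Phi>' (Suc i) (\<Phi> i (0, \<eta>))) = k * \<eta> ^ n (Suc i)"
      using step[of i] unfolding cable_step_def by blast
    let ?\<beta> = "snd \<circ> (\<Phi>' (Suc i) \<circ> \<Phi> i)"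
    have im: "\<Phi> i ` torus_complement \<subseteq> U (Suc i)" using U_Suc U_eq by blast
    have "continuous_on torus_complement ?\<beta>"
      using U_homeo[of i] U_homeo[of "Suc i"] im
      by (intro continuous_on_compose) (auto simp: homeomorphism_def intro: continuous_intros continuous_on_subset)
    moreover have "?\<beta> y \<noteq> 0" if "y \<in> torus_complement" for y
    proof -
      have "\<Phi>' (Suc i) (\<Phi> i y) \<in> torus_complement"
        using im that U_homeo[of "Suc i"] unfolding homeomorphism_def by blast
      then show ?thesis using torus_complement_fst(2) by simp
    qed
    ultimately have "wind ?\<beta> (\<Phi>' i \<circ> p) = of_nat (n (Suc i)) * wind snd (\<Phi>' i \<circ> p)"
      by (rule torus_complement_degree[OF loops_pull[OF p]]) (use k in auto)
    moreover have "wind ?\<beta> (\<Phi>' i \<circ> p) = wind (\<theta> (Suc i)) p"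
      unfolding wind_def by (rule winding_number_cong) (simp add: \<theta>_def push_pull[OF p])
    ultimately show ?thesis by (simp add: wind_\<theta>)
  qed
qed

end

section \<open>Solenoids with prescribed groups of the complement\<close>

text \<open>The same defining sequence serves the solenoid, the braided tori and the group.\<close>
lemma solenoid_embedding_with_fractions_group:
  assumes n: "defining_sequence n" and \<Sigma>: "\<Sigma> homeomorphic_space solenoid_space n"
  obtains e where "solenoid_embedding \<Sigma> e"
    "\<And>x. x \<in> S3 - e ` topspace \<Sigma> \<Longrightarrow>
       fundamental_group (S3 - e ` topspace \<Sigma>) x \<cong> rat_group\<lparr>carrier := fractions_group n\<rparr>"
proof -
  obtain \<Phi> \<Phi>' f where "\<And>i. homeomorphism S3C S3 (\<Phi> i) (\<Phi>' i)"
    "\<And>i :: nat. cable_step (n (Suc i)) (\<Phi> i) (\<Phi> (Suc i)) (\<Phi>' (Suc i)) (f i)"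
    using cable_tower_exists[OF n] by metis
  then interpret cable_tower n \<Phi> \<Phi>' f using n by unfold_locales
  let ?X = "\<Inter>i. h i ` solid_torus"
  have "\<Sigma> homeomorphic_space top_of_set ?X"
    using \<Sigma> intersection_homeomorphic homeomorphic_space_sym homeomorphic_space_trans by blast
  then obtain e where e: "homeomorphic_map \<Sigma> (top_of_set ?X) e"
    by (auto simp: homeomorphic_space)
  then have im: "e ` topspace \<Sigma> = ?X" using homeomorphic_imp_surjective_map[OF e] by simp
  have sub: "?X \<subseteq> S3" using h_embedding(3)[of 0] by blast
  have "embedding_map \<Sigma> (top_of_set S3) e"
    unfolding embedding_map_def im using e sub by (simp add: subtopology_subtopology Int_absorb1)
  then have "solenoid_embedding \<Sigma> e"
    unfolding solenoid_embedding_def using n \<Sigma> nested_braided_tori_h im by blast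
  then show ?thesis using that[of e] fundamental_group_tower unfolding im by blast
qed

theorem theorem3p5:
  shows "(\<forall>\<Sigma> :: 'a topology. solenoid \<Sigma> \<longrightarrow>
            (\<exists>e. solenoid_embedding \<Sigma> e \<and>
               (\<forall>x \<in> S3 - e ` topspace \<Sigma>.
                  comm_group (fundamental_group (S3 - e ` topspace \<Sigma>) x)) \<and>
               (\<exists>H. subgroup H rat_group \<and>
                  (\<forall>x \<in> S3 - e ` topspace \<Sigma>.
                     fundamental_group (S3 - e ` topspace \<Sigma>) x \<cong> rat_group\<lparr>carrier := H\<rparr>)))) \<and>
         (\<forall>G. subgroup G rat_group \<and> G \<noteq> {0} \<longrightarrow>
            (\<exists>(\<Sigma> :: (nat \<Rightarrow> complex) topology) e. solenoid \<Sigma> \<and> solenoid_embedding \<Sigma> e \<and>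
               (\<forall>x \<in> S3 - e ` topspace \<Sigma>.
                  fundamental_group (S3 - e ` topspace \<Sigma>) x \<cong> rat_group\<lparr>carrier := G\<rparr>)))"
proof (intro conjI allI impI)
  fix \<Sigma> :: "'a topology" assume "solenoid \<Sigma>"
  then obtain n where n: "defining_sequence n" "\<Sigma> homeomorphic_space solenoid_space n"
    by (auto simp: solenoid_def)
  obtain e where e: "solenoid_embedding \<Sigma> e"
    "\<And>x. x \<in> S3 - e ` topspace \<Sigma> \<Longrightarrow>
       fundamental_group (S3 - e ` topspace \<Sigma>) x \<cong> rat_group\<lparr>carrier := fractions_group n\<rparr>"
    using solenoid_embedding_with_fractions_group[OF n] by metis
  let ?R = "rat_group\<lparr>carrier := fractions_group n\<rparr>"
  have "group ?R" by (rule subgroup.subgroup_is_group[OF subgroup_fractions_group group_rat_group])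
  then interpret R: comm_group ?R
    by (intro group.group_comm_groupI) (auto simp: rat_group_def)
  have "comm_group (fundamental_group (S3 - e ` topspace \<Sigma>) x)" if x: "x \<in> S3 - e ` topspace \<Sigma>" for x
  proof -
    have G: "group (fundamental_group (S3 - e ` topspace \<Sigma>) x)" using x by (rule group_fundamental_group)
    then show ?thesis
      using R.iso_imp_comm_group[OF group.iso_sym[OF G e(2)[OF x]] group.is_monoid[OF G]] by simp
  qed
  then show "\<exists>e. solenoid_embedding \<Sigma> e \<and>
      (\<forall>x \<in> S3 - e ` topspace \<Sigma>. comm_group (fundamental_group (S3 - e ` topspace \<Sigma>) x)) \<and>
      (\<exists>H. subgroup H rat_group \<and> (\<forall>x \<in> S3 - e ` topspace \<Sigma>.
         fundamental_group (S3 - e ` topspace \<Sigma>) x \<cong> rat_group\<lparr>carrier := H\<rparr>))"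
    using e subgroup_fractions_group[of n] by blast
next
  fix G assume G: "subgroup G rat_group \<and> G \<noteq> {0}"
  then obtain n where n: "defining_sequence n" "rat_group\<lparr>carrier := fractions_group n\<rparr> \<cong> rat_group\<lparr>carrier := G\<rparr>"
    using nontrivial_rat_subgroup_iso_fractions_group[of G] by metis
  obtain e where e: "solenoid_embedding (solenoid_space n) e"
    "\<And>x. x \<in> S3 - e ` topspace (solenoid_space n) \<Longrightarrow>
       fundamental_group (S3 - e ` topspace (solenoid_space n)) x \<cong> rat_group\<lparr>carrier := fractions_group n\<rparr>"
    using solenoid_embedding_with_fractions_group[OF n(1) homeomorphic_space_refl] by metis
  have "solenoid (solenoid_space n)"
    unfolding solenoid_def using n(1) homeomorphic_space_refl by blast
  moreover have "fundamental_group (S3 - e ` topspace (solenoid_space n)) x \<cong> rat_group\<lparr>carrier := G\<rparr>"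
    if x: "x \<in> S3 - e ` topspace (solenoid_space n)" for x
    using e(2)[OF x] n(2) by (rule iso_trans)
  ultimately show "\<exists>(\<Sigma> :: (nat \<Rightarrow> complex) topology) e. solenoid \<Sigma> \<and> solenoid_embedding \<Sigma> e \<and>
      (\<forall>x \<in> S3 - e ` topspace \<Sigma>.
         fundamental_group (S3 - e ` topspace \<Sigma>) x \<cong> rat_group\<lparr>carrier := G\<rparr>)"
    using e(1) by blast
qed

end
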